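(* For every infinite cardinal $\lambda$ there is a Noetherian ring, in fact a Noetherian (integral) domain, of cardinality $\lambda$ whose additive group is a free abelian group. *)

theory Defs
  imports "HOL-Algebra.Algebra"
begin

unbundle cardinal_syntax

text \<open>
  Indexing the basis by a subset of the type of group elements is no restriction: every basis
  of a free abelian group is a subset of the group. The trivial group (empty basis) is free.
\<close>

definition free_abelian :: "('a, 'm) monoid_scheme \<Rightarrow> bool" where
  "free_abelian G \<longleftrightarrow> (\<exists>S :: 'a set. G \<cong> free_Abelian_group S)"

end

theory Submission
  imports Defs "HOL-Computational_Algebra.Fraction_Field" "HOL-Combinatorics.Transposition"
begin

text \<open>
  Let \<open>W\<close> be an infinite set of variables. The ring is the Nagata ring \<open>R(W)\<close>: the fractions
  \<open>f / g\<close> of integer Laurent polynomials in the variables \<open>W\<close> whose denominator \<open>g\<close> is primitive,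
  that is, has content \<open>1\<close>. Allowing negative exponents does not change the ring, since monomials
  are primitive, and it makes the monomials a group.

  Noetherian: by Gauss's lemma every nonzero element of \<open>R(W)\<close> is a positive integer times a unit
  (\<open>nagata_int_unit_factor\<close>), so every ideal is generated by one integer. The cardinality of \<open>R(W)\<close>
  is that of \<open>W\<close>.

  Free: this is the point of the proof.

  For countable subgroups it follows from Pontryagin's criterion
  (\<open>countable_group_has_basis\<close>). Finitely many elements of \<open>R(W)\<close> have a common primitive denominator
  \<open>g\<close>; the fractions over \<open>g\<close> form a copy of the free group of Laurent polynomials, and this copy is
  pure in \<open>R(W)\<close> by Gauss's lemma. Hence an element outside a pure subgroup of finite rank is divisible
  by only finitely many integers modulo that subgroup, and a basis is built one element at a time.

  For arbitrary \<open>W\<close>, single out one variable \<open>Base\<close> in \<open>W\<close> and give each other variable \<open>x\<close> a copy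
  outside \<open>W\<close>. Let \<open>\<sigma>\<^sub>x\<close> be the automorphism exchanging \<open>x\<close> with its copy, and for a finite set \<open>P\<close> of
  variables let \<open>D\<^sub>P\<close> be the product of the operators \<open>1 - \<sigma>\<^sub>x\<close> for \<open>x\<close> in \<open>P\<close>. Write \<open>R\<^sub>P\<close> for the Nagata
  ring in the variables \<open>Base\<close> and \<open>P\<close>. Two facts carry the argument. The operator \<open>D\<^sub>P\<close> kills \<open>R\<^sub>Q\<close>
  unless \<open>P \<subseteq> Q\<close>. Its kernel on \<open>R\<^sub>P\<close> is the sum of the rings \<open>R\<^bsub>P - {x}\<^esub>\<close> (\<open>diff_op_kernel\<close>): if
  \<open>D\<^sub>P r = 0\<close>, expanding the product writes \<open>r\<close> as a sum of elements each avoiding some \<open>x\<close> in \<open>P\<close>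
  but involving copies, and the copies are removed by substituting high powers of \<open>Base\<close> for them;
  if the powers are high enough, distinct monomials of the denominators stay distinct, so the
  denominators remain primitive.

  The group \<open>D\<^sub>P(R\<^sub>P)\<close> is a countable subgroup of a Nagata ring and so has a basis. Lift it to
  \<open>B\<^sub>P \<subseteq> R\<^sub>P\<close>. The union of the sets \<open>B\<^sub>P\<close> over all finite \<open>P\<close> is a basis of \<open>R(W)\<close>. It spans by induction
  on \<open>P\<close>, because \<open>B\<^sub>P\<close> spans \<open>R\<^sub>P\<close> modulo the kernel of \<open>D\<^sub>P\<close>. It is independent, because in a linear
  relation one may choose \<open>P\<close> of maximal size among the sets involved, and applying \<open>D\<^sub>P\<close> leaves only
  the terms from \<open>B\<^sub>P\<close>.
\<close>

section \<open>Bases of countable abelian groups\<close>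

text \<open>
  Abelian groups are treated as integer modules inside commutative rings, so that scalar
  multiplication is multiplication by \<^term>\<open>of_int n\<close> and the general theory of modules applies.
\<close>

global_interpretation zm: Modules.module "\<lambda>(n::int) (x::'a::comm_ring_1). of_int n * x"
  defines zspan = zm.span and zsubspace = zm.subspace and zdependent = zm.dependent
  by standard (simp_all add: algebra_simps)

lemma zmodule: "Modules.module (\<lambda>n. (*) (of_int n :: 'a::comm_ring_1))"
  by (rule zm.module_axioms)

abbreviation "zindependent B \<equiv> \<not> zdependent B"

lemma additive_of_int_mult:
  fixes f :: "'a::comm_ring_1 \<Rightarrow> 'b::comm_ring_1"
  assumes "Modules.additive f"
  shows "f (of_int n * x) = of_int n * f x"
proof -
  interpret Modules.additive f by fact
  show ?thesis
    by (induction n rule: int_induct[where k = 0])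
      (simp_all add: zero add diff algebra_simps)
qed

lemma additive_imp_module_hom:
  fixes f :: "'a::comm_ring_1 \<Rightarrow> 'b::comm_ring_1"
  assumes "Modules.additive f"
  shows "Modules.module_hom (\<lambda>n. (*) (of_int n)) (\<lambda>n. (*) (of_int n)) f"
  using assms
  by (simp add: module_hom_iff additive_of_int_mult Modules.additive_def zmodule)

lemma additive_zspan_image:
  fixes f :: "'a::comm_ring_1 \<Rightarrow> 'b::comm_ring_1"
  assumes "Modules.additive f"
  shows "zspan (f ` S) = f ` zspan S"
  using module_hom.span_image[OF additive_imp_module_hom[OF assms]]
  by (simp add: zspan_def)

lemma additive_zero_on_zspan:
  fixes f :: "'a::comm_ring_1 \<Rightarrow> 'b::comm_ring_1"
  assumes "Modules.additive f" "\<And>b. b \<in> B \<Longrightarrow> f b = 0" "x \<in> zspan B"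
  shows "f x = 0"
  using module_hom.eq_0_on_span[OF additive_imp_module_hom[OF assms(1)], of B x] assms(2,3)
  by (simp add: zspan_def)

definition torsionless :: "'a::comm_ring_1 itself \<Rightarrow> bool" where
  "torsionless _ \<longleftrightarrow> (\<forall>x::'a. x \<noteq> 0 \<longrightarrow> (\<exists>\<phi>::'a \<Rightarrow> int. Modules.additive \<phi> \<and> \<phi> x \<noteq> 0))"

text \<open>
  The functionals are found by Gaussian elimination: if \<open>\<phi>\<close> kills \<open>B\<close> but not \<open>b\<close>, then a functional \<open>\<psi>\<close>
  that kills \<open>B\<close> but not the combination \<open>\<phi>(b) e - \<phi>(e) b\<close> can be corrected by a multiple of \<open>\<phi>\<close> so as
  to kill \<open>b\<close> as well.
\<close>

lemma torsionless_separation: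
  fixes e :: "'a::comm_ring_1"
  assumes "torsionless TYPE('a)" "finite B"
    and "\<And>n. n \<noteq> 0 \<Longrightarrow> of_int n * e \<notin> zspan B"
  shows "\<exists>\<phi>::'a \<Rightarrow> int. Modules.additive \<phi> \<and> (\<forall>b\<in>B. \<phi> b = 0) \<and> \<phi> e \<noteq> 0"
  using assms(2,3)
proof (induction B arbitrary: e rule: finite_induct)
  case empty
  have "e \<noteq> 0" using empty[of 1] by auto
  then show ?case using assms(1) by (auto simp: torsionless_def)
next
  case (insert b B)
  have sub: "zspan B \<subseteq> zspan (insert b B)" by (rule zm.span_mono) blast
  show ?case
  proof (cases "\<exists>n. n \<noteq> 0 \<and> of_int n * b \<in> zspan B")
    case True
    then obtain n where n: "n \<noteq> 0" "of_int n * b \<in> zspan B" by blast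
    obtain \<phi> :: "'a \<Rightarrow> int" where \<phi>: "Modules.additive \<phi>" "\<forall>b\<in>B. \<phi> b = 0" "\<phi> e \<noteq> 0"
      using insert.IH[of e] insert.prems sub by blast
    have "\<phi> (of_int n * b) = 0"
      using additive_zero_on_zspan[OF \<phi>(1)] \<phi>(2) n(2) by blast
    then have "\<phi> b = 0" using n(1) by (simp add: additive_of_int_mult[OF \<phi>(1)])
    then show ?thesis using \<phi> by auto
  next
    case False
    obtain \<phi> :: "'a \<Rightarrow> int" where \<phi>: "Modules.additive \<phi>" "\<forall>b\<in>B. \<phi> b = 0" "\<phi> b \<noteq> 0"
      using insert.IH[of b] False by blast
    \<comment> \<open>the combination of \<open>e\<close> and \<open>b\<close> on which \<open>\<phi>\<close> vanishes\<close>
    define e' where "e' = of_int (\<phi> b) * e - of_int (\<phi> e) * b"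
    have "of_int n * e' \<notin> zspan B" if "n \<noteq> 0" for n
    proof
      assume "of_int n * e' \<in> zspan B"
      then have "of_int (n * \<phi> b) * e - of_int (n * \<phi> e) * b \<in> zspan B"
        by (simp add: e'_def algebra_simps)
      then have "of_int (n * \<phi> b) * e \<in> zspan (insert b B)"
        using zm.span_breakdown_eq by blast
      then show False using insert.prems[of "n * \<phi> b"] that \<phi>(3) by auto
    qed
    then obtain \<psi> :: "'a \<Rightarrow> int" where \<psi>: "Modules.additive \<psi>" "\<forall>b\<in>B. \<psi> b = 0" "\<psi> e' \<noteq> 0"
      using insert.IH[of e'] by blast
    define \<chi> where "\<chi> x = \<phi> b * \<psi> x - \<psi> b * \<phi> x" for x
    have "Modules.additive \<chi>"
      using \<phi>(1) \<psi>(1) by (auto simp: \<chi>_def Modules.additive_def algebra_simps)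
    moreover have "\<forall>a\<in>insert b B. \<chi> a = 0"
      using \<phi> \<psi> by (auto simp: \<chi>_def)
    moreover have "\<chi> e = \<psi> e'"
      by (simp add: \<chi>_def e'_def Modules.additive.diff[OF \<psi>(1)] additive_of_int_mult[OF \<psi>(1)])
    ultimately show ?thesis using \<psi>(3) by metis
  qed
qed

lemma zindependent_insert:
  fixes B :: "'a::comm_ring_1 set"
  assumes "zindependent B" "\<And>n. n \<noteq> 0 \<Longrightarrow> of_int n * a \<notin> zspan B"
  shows "zindependent (insert a B)"
  unfolding zm.independent_explicit_module
proof (intro allI impI)
  fix t u v
  assume t: "finite t" "t \<subseteq> insert a B" "(\<Sum>v\<in>t. of_int (u v) * v) = 0" "v \<in> t"
  have t': "finite (t - {a})" "t - {a} \<subseteq> B" using t by auto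
  have s: "(\<Sum>v\<in>t - {a}. of_int (u v) * v) \<in> zspan B"
    using t' by (intro zm.span_sum zm.span_scale zm.span_base) auto
  have ua: "u a = 0" if "a \<in> t"
  proof (rule ccontr)
    assume "u a \<noteq> 0"
    have "of_int (u a) * a = - (\<Sum>v\<in>t - {a}. of_int (u v) * v)"
      using t(1,3) that by (simp add: sum.remove eq_neg_iff_add_eq_0)
    then have "of_int (u a) * a \<in> zspan B" using s zm.span_neg by metis
    then show False using assms(2) \<open>u a \<noteq> 0\<close> by blast
  qed
  have "(\<Sum>v\<in>t - {a}. of_int (u v) * v) = 0"
  proof (cases "a \<in> t")
    case True
    then show ?thesis using ua t(1,3) by (simp add: sum.remove)
  next
    case False
    then show ?thesis using t(3) by simp
  qed
  then have "u w = 0" if "w \<in> t - {a}" for w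
    using zm.independentD[OF assms(1) t'(1,2), of u w] that by blast
  then show "u v = 0" using ua t(4) by blast
qed

text \<open>
  The usual notion of purity of \<open>L\<close> in a torsion-free \<open>A\<close>, stated without assuming \<open>L \<subseteq> A\<close>.
\<close>

definition pure_in :: "'a::comm_ring_1 set \<Rightarrow> 'a set \<Rightarrow> bool" where
  "pure_in L A \<longleftrightarrow> (\<forall>a\<in>A. \<forall>n. n \<noteq> 0 \<longrightarrow> of_int n * a \<in> L \<longrightarrow> a \<in> L)"

text \<open>
  Modulo the pure subgroup spanned by \<open>B\<close>, the elements having a multiple in the subgroup
  generated by \<open>e\<close> form a torsion-free group of rank one. The bound says that only finitely many
  integers divide \<open>e\<close> there, so the group is cyclic: dividing \<open>e\<close> by the largest possible integer
  gives a generator, and this is the new basis element.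
\<close>

lemma extend_pure_basis:
  fixes A :: "'a::comm_ring_1 set"
  assumes A: "zsubspace A" and B: "finite B" "B \<subseteq> A" "zindependent B" "pure_in (zspan B) A"
    and e: "e \<in> A"
    and bound: "e \<notin> zspan B \<Longrightarrow> \<exists>N. \<forall>k a. a \<in> A \<longrightarrow> e - of_int k * a \<in> zspan B \<longrightarrow> k \<le> N"
  shows "\<exists>B'. finite B' \<and> B' \<subseteq> A \<and> zindependent B' \<and> pure_in (zspan B') A \<and> B \<subseteq> B' \<and> e \<in> zspan B'"
proof (cases "e \<in> zspan B")
  case True
  then show ?thesis using B by blast
next
  case False
  define D where "D = {k. 0 < k \<and> (\<exists>a\<in>A. e - of_int k * a \<in> zspan B)}"
  have spanA: "zspan B \<subseteq> A" using A B(2) by (rule zm.span_minimal[rotated])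
  obtain N where "\<forall>k a. a \<in> A \<longrightarrow> e - of_int k * a \<in> zspan B \<longrightarrow> k \<le> N"
    using bound False by blast
  then have "D \<subseteq> {0..N}" by (auto simp: D_def)
  then have finD: "finite D" using finite_subset by blast
  have "1 \<in> D" unfolding D_def using e zm.span_zero by (auto intro!: bexI[of _ e])
  define k where "k = Max D"
  have "k \<in> D" unfolding k_def using finD \<open>1 \<in> D\<close> by (intro Max_in) auto
  then obtain a where a: "k > 0" "a \<in> A" "e - of_int k * a \<in> zspan B"
    by (auto simp: D_def)
  have na: "of_int n * a \<notin> zspan B" if "n \<noteq> 0" for n
  proof
    assume "of_int n * a \<in> zspan B"
    then have "a \<in> zspan B" using B(4) a(2) that by (auto simp: pure_in_def)
    then have "(e - of_int k * a) + of_int k * a \<in> zspan B"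
      using a(3) by (intro zm.span_add zm.span_scale)
    then show False using False by simp
  qed
  have "pure_in (zspan (insert a B)) A"
    unfolding pure_in_def
  proof (intro ballI allI impI)
    fix u n
    assume u: "u \<in> A" and n: "n \<noteq> 0" and "of_int n * u \<in> zspan (insert a B)"
    then obtain c where c: "of_int n * u - of_int c * a \<in> zspan B"
      by (auto simp: zm.span_breakdown_eq)
    define g where "g = gcd n c"
    have g: "g \<noteq> 0" using n by (simp add: g_def)
    obtain n' c' where nc: "n = g * n'" "c = g * c'" "coprime n' c'"
      using gcd_coprime_exists[of n c] g by (metis g_def mult.commute)
    have "of_int g * (of_int n' * u - of_int c' * a) \<in> zspan B"
      using c by (simp add: nc algebra_simps)
    moreover have "of_int n' * u - of_int c' * a \<in> A"
      using u a(2) A by (intro zm.subspace_diff zm.subspace_scale)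
    ultimately have d: "of_int n' * u - of_int c' * a \<in> zspan B"
      using B(4) g by (auto simp: pure_in_def)
    obtain \<alpha> \<beta> where ab: "\<alpha> * n' + \<beta> * c' = 1"
      using nc(3) by (metis bezout_int coprime_imp_gcd_eq_1)
    \<comment> \<open>modulo the span of \<open>B\<close>, \<open>a = n' w\<close>, so \<open>k n'\<close> divides \<open>e\<close> and maximality of \<open>k\<close> gives \<open>n' = \<plusminus>1\<close>\<close>
    define w where "w = of_int \<alpha> * a + of_int \<beta> * u"
    have w: "w \<in> A" unfolding w_def using u a(2) A by (intro zm.subspace_add zm.subspace_scale)
    have "a = of_int (\<alpha> * n' + \<beta> * c') * a" by (simp add: ab)
    then have "of_int n' * w - a = of_int \<beta> * (of_int n' * u - of_int c' * a)"
      by (simp add: w_def algebra_simps)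
    then have wa: "of_int n' * w - a \<in> zspan B" using zm.span_scale[OF d] by metis
    have "e - of_int (k * n') * w = (e - of_int k * a) - of_int k * (of_int n' * w - a)"
      by (simp add: algebra_simps)
    then have kn: "e - of_int (k * n') * w \<in> zspan B"
      using zm.span_diff[OF a(3) zm.span_scale[OF wa]] by metis
    have kn': "e - of_int (k * - n') * (- w) \<in> zspan B" using kn by simp
    have w': "- w \<in> A" using w A by (rule zm.subspace_neg[rotated])
    have "n' \<noteq> 0" using n nc(1) by auto
    have "k * \<bar>n'\<bar> \<in> D"
    proof (cases "n' > 0")
      case True
      then show ?thesis unfolding D_def using a(1) kn w by (auto simp del: of_int_mult)
    next
      case False
      then have "\<bar>n'\<bar> = - n'" "k * - n' > 0" using a(1) \<open>n' \<noteq> 0\<close> by (auto intro: mult_pos_neg)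
      then show ?thesis unfolding D_def using kn' w' by (metis (mono_tags, lifting) mem_Collect_eq)
    qed
    then have "k * \<bar>n'\<bar> \<le> k" unfolding k_def using finD by (intro Max_ge)
    then have "\<bar>n'\<bar> = 1" using a(1) n nc(1) by (cases "n' = 0") auto
    then have "u = of_int n' * ((of_int n' * u - of_int c' * a) + of_int c' * a)"
      by (auto simp: abs_if split: if_splits)
    moreover have "\<dots> \<in> zspan (insert a B)"
    proof (intro zm.span_scale zm.span_add)
      show "of_int n' * u - of_int c' * a \<in> zspan (insert a B)"
        using d zm.span_mono[of B "insert a B"] by blast
    qed (simp add: zm.span_base)
    ultimately show "u \<in> zspan (insert a B)" by simp
  qed
  moreover have "e \<in> zspan (insert a B)"
    using a(3) zm.span_breakdown_eq by blast
  ultimately show ?thesis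
    using B a(2) zindependent_insert[OF B(3) na] by (intro exI[of _ "insert a B"]) auto
qed

text \<open>
  Pontryagin's criterion, in the form needed for rings of fractions: every finite subset of \<open>A\<close>
  lies in a pure copy \<open>range \<iota>\<close> of a torsionless group. A functional on that group which kills a pure
  subgroup of finite rank but not \<open>e\<close> takes at \<open>e\<close> a nonzero value divisible by every integer that
  divides \<open>e\<close> modulo the subgroup, whence the bound of the previous lemma.
\<close>

lemma countable_group_has_basis:
  fixes A :: "'a::comm_ring_1 set"
  assumes A: "zsubspace A" "countable A"
    and tl: "torsionless TYPE('b::comm_ring_1)"
    and L: "\<And>F. finite F \<Longrightarrow> F \<subseteq> A \<Longrightarrow>
      \<exists>\<iota>::'b \<Rightarrow> 'a. Modules.additive \<iota> \<and> inj \<iota> \<and> F \<subseteq> range \<iota> \<and> pure_in (range \<iota>) A"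
  shows "\<exists>B. B \<subseteq> A \<and> zindependent B \<and> zspan B = A"
proof -
  have "A \<noteq> {}" using zm.subspace_0[OF A(1)] by blast
  then obtain e :: "nat \<Rightarrow> 'a" where e: "A = range e"
    using A(2) by (metis range_from_nat_into)
  define P where "P B \<longleftrightarrow> finite B \<and> B \<subseteq> A \<and> zindependent B \<and> pure_in (zspan B) A" for B
  have bound: "\<exists>N. \<forall>k a. a \<in> A \<longrightarrow> x - of_int k * a \<in> zspan B \<longrightarrow> k \<le> N"
    if B: "P B" and x: "x \<in> A" "x \<notin> zspan B" for B x
  proof -
    obtain \<iota> :: "'b \<Rightarrow> 'a" where \<iota>: "Modules.additive \<iota>" "inj \<iota>" "insert x B \<subseteq> range \<iota>"
        "pure_in (range \<iota>) A"
      using L[of "insert x B"] B x by (auto simp: P_def)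
    obtain x' B' where x': "x = \<iota> x'" and B': "B = \<iota> ` B'"
      using \<iota>(3) unfolding insert_subset by (metis imageE subset_imageE)
    have fB': "finite B'" using B B' \<iota>(2) finite_image_iff inj_on_subset
      by (metis P_def subset_UNIV)
    have spn: "\<iota> y \<in> zspan B \<longleftrightarrow> y \<in> zspan B'" for y
      unfolding B' additive_zspan_image[OF \<iota>(1)] using \<iota>(2) by (simp add: inj_image_mem_iff)
    have "of_int n * x' \<notin> zspan B'" if "n \<noteq> 0" for n
    proof
      assume "of_int n * x' \<in> zspan B'"
      then have "of_int n * x \<in> zspan B"
        by (simp add: spn[symmetric] additive_of_int_mult[OF \<iota>(1)] x')
      then show False using B x that by (auto simp: P_def pure_in_def)
    qed
    then obtain \<phi> :: "'b \<Rightarrow> int" where \<phi>: "Modules.additive \<phi>" "\<forall>b\<in>B'. \<phi> b = 0" "\<phi> x' \<noteq> 0"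
      using torsionless_separation[OF tl fB', of x'] by auto
    show ?thesis
    proof (intro exI allI impI)
      fix k a assume a: "a \<in> A" "x - of_int k * a \<in> zspan B"
      show "k \<le> \<bar>\<phi> x'\<bar>"
      proof (cases "k = 0")
        case False
        have "x - of_int k * a \<in> range \<iota>"
          using a(2) by (auto simp: B' additive_zspan_image[OF \<iota>(1)])
        then obtain y where y: "x - of_int k * a = \<iota> y" by blast
        then have "of_int k * a = \<iota> (x' - y)"
          by (simp add: x' Modules.additive.diff[OF \<iota>(1)] algebra_simps)
        then obtain a' where a': "a = \<iota> a'"
          using \<iota>(4) a(1) False unfolding pure_in_def by (metis rangeE rangeI)
        have "\<iota> (x' - of_int k * a') \<in> zspan B"
          using a(2) by (simp add: x' a' Modules.additive.diff[OF \<iota>(1)] additive_of_int_mult[OF \<iota>(1)])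
        then have "\<phi> (x' - of_int k * a') = 0"
          using additive_zero_on_zspan[OF \<phi>(1)] \<phi>(2) spn by blast
        then have "\<phi> x' = k * \<phi> a'"
          by (simp add: Modules.additive.diff[OF \<phi>(1)] additive_of_int_mult[OF \<phi>(1)])
        then have "k dvd \<phi> x'" by simp
        then have "\<bar>k\<bar> \<le> \<bar>\<phi> x'\<bar>" using \<phi>(3) by (rule dvd_imp_le_int[rotated])
        then show ?thesis by simp
      qed simp
    qed
  qed
  have "P {}"
  proof -
    obtain \<iota> :: "'b \<Rightarrow> 'a" where \<iota>: "Modules.additive \<iota>" "inj \<iota>" "pure_in (range \<iota>) A"
      using L[of "{}"] by auto
    have "a = 0" if a: "a \<in> A" "n \<noteq> 0" "of_int n * a = 0" for a n
    proof (rule ccontr)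
      assume "a \<noteq> 0"
      have z: "\<iota> 0 = 0" using \<iota>(1) by (rule Modules.additive.zero)
      have "of_int n * a \<in> range \<iota>" using a(3) z by (metis rangeI)
      then obtain a' where a': "a = \<iota> a'"
        using a(1,2) \<iota>(3) unfolding pure_in_def by (metis rangeE)
      then have "\<iota> (of_int n * a') = \<iota> 0"
        using a(3) z by (simp add: additive_of_int_mult[OF \<iota>(1)])
      then have na': "of_int n * a' = 0" using \<iota>(2) by (simp add: inj_eq)
      have "a' \<noteq> 0" using a' \<open>a \<noteq> 0\<close> z by auto
      then obtain \<phi> :: "'b \<Rightarrow> int" where \<phi>: "Modules.additive \<phi>" "\<phi> a' \<noteq> 0"
        using tl by (auto simp: torsionless_def)
      have "\<phi> (of_int n * a') = 0" using \<phi>(1) na' by (simp add: Modules.additive.zero)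
      then show False using \<phi> a(2) by (simp add: additive_of_int_mult[OF \<phi>(1)])
    qed
    then show ?thesis using zm.independent_empty by (auto simp: P_def pure_in_def)
  qed
  have "\<exists>f. \<forall>n. P (f n) \<and> (f n \<subseteq> f (Suc n) \<and> e n \<in> zspan (f (Suc n)))"
  proof (rule dependent_nat_choice)
    show "\<exists>B. P B" using \<open>P {}\<close> by blast
  next
    fix B n assume "P B"
    then show "\<exists>B'. P B' \<and> B \<subseteq> B' \<and> e n \<in> zspan B'"
      using extend_pure_basis[OF A(1), of B "e n"] bound[OF \<open>P B\<close>, of "e n"] e
      unfolding P_def by blast
  qed
  then obtain f where f: "\<And>n. P (f n)" "\<And>n. f n \<subseteq> f (Suc n)" "\<And>n. e n \<in> zspan (f (Suc n))"
    by blast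
  have mono: "f m \<subseteq> f n" if "m \<le> n" for m n
    using f(2) that by (rule lift_Suc_mono_le)
  have "zindependent (\<Union> (range f))"
  proof (rule zm.independent_Union_directed)
    show "c \<subseteq> d \<or> d \<subseteq> c" if "c \<in> range f" "d \<in> range f" for c d
      using that mono by (metis imageE nle_le)
  qed (use f(1) in \<open>auto simp: P_def\<close>)
  moreover have sub: "\<Union> (range f) \<subseteq> A" using f(1) by (auto simp: P_def)
  moreover have "zspan (\<Union> (range f)) = A"
  proof
    show "zspan (\<Union> (range f)) \<subseteq> A" using sub A(1) by (rule zm.span_minimal)
    show "A \<subseteq> zspan (\<Union> (range f))"
      unfolding e using f(3) zm.span_mono[of "f (Suc _)" "\<Union> (range f)"] by blast
  qed
  ultimately show ?thesis by blast
qed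

section \<open>Content and Gauss's lemma for group rings over the integers\<close>

abbreviation lookup where "lookup \<equiv> Poly_Mapping.lookup"
abbreviation keys where "keys \<equiv> Poly_Mapping.keys"

lemma lookup_of_int_mult:
  fixes f :: "'m::comm_monoid_add \<Rightarrow>\<^sub>0 int"
  shows "lookup (of_int c * f) m = c * lookup f m"
  by (induction c rule: int_induct[where k = 0])
    (simp_all add: distrib_right left_diff_distrib lookup_add lookup_minus)

lemma lookup_times:
  fixes f g :: "'m::comm_monoid_add \<Rightarrow>\<^sub>0 int"
  shows "lookup (f * g) k =
    (\<Sum>(m, n)\<in>keys f \<times> keys g. if m + n = k then lookup f m * lookup g n else 0)"
proof -
  have *: "h = (\<Sum>m\<in>keys h. Poly_Mapping.single m (lookup h m))" for h :: "'m \<Rightarrow>\<^sub>0 int"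
  proof (rule poly_mapping_eqI)
    fix m
    show "lookup h m = lookup (\<Sum>m\<in>keys h. Poly_Mapping.single m (lookup h m)) m"
      by (cases "m \<in> keys h") (auto simp: lookup_sum lookup_single when_def in_keys_iff)
  qed
  have "f * g = (\<Sum>m\<in>keys f. Poly_Mapping.single m (lookup f m)) *
      (\<Sum>n\<in>keys g. Poly_Mapping.single n (lookup g n))"
    by (rule arg_cong2[where f = "(*)", OF * *])
  also have "\<dots> = (\<Sum>(m, n)\<in>keys f \<times> keys g. Poly_Mapping.single (m + n) (lookup f m * lookup g n))"
    by (simp add: sum_product sum.cartesian_product mult_single)
  finally have "lookup (f * g) k = lookup \<dots> k" by (rule arg_cong)
  then show ?thesis
    by (simp only: lookup_sum) (simp add: lookup_single when_def split_def)
qed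

definition content :: "('m \<Rightarrow>\<^sub>0 int) \<Rightarrow> int" where
  "content f = Gcd (range (lookup f))"

abbreviation primitive :: "('m \<Rightarrow>\<^sub>0 int) \<Rightarrow> bool" where
  "primitive f \<equiv> content f = 1"

lemma dvd_content_iff: "n dvd content f \<longleftrightarrow> (\<forall>m. n dvd lookup f m)"
  by (auto simp: content_def dvd_Gcd_iff)

lemma content_nonneg: "content f \<ge> 0"
  by (simp add: content_def)

lemma content_eq_0_iff: "content f = 0 \<longleftrightarrow> f = 0"
  by (auto simp: content_def image_subset_iff intro!: poly_mapping_eqI)

lemma primitive_nonzero: "primitive f \<Longrightarrow> f \<noteq> 0"
  using content_eq_0_iff[of f] by auto

lemma primitive_one: "primitive (1 :: 'm::comm_monoid_add \<Rightarrow>\<^sub>0 int)"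
proof -
  have "content (1 :: 'm \<Rightarrow>\<^sub>0 int) dvd 1"
    using dvd_content_iff[of "content 1" "1 :: 'm \<Rightarrow>\<^sub>0 int"] by (auto dest: spec[of _ 0])
  then show ?thesis using content_nonneg[of "1 :: 'm \<Rightarrow>\<^sub>0 int"] by simp
qed

lemma primitiveI:
  assumes "\<And>p. Factorial_Ring.prime p \<Longrightarrow> \<not> p dvd content f"
  shows "primitive f"
proof -
  have "content f dvd 1"
  proof (cases "content f = 0")
    case True
    then show ?thesis using assms[of 2] by simp
  next
    case False
    then show ?thesis using assms prime_divisor_exists[of "content f"] by blast
  qed
  then show ?thesis using content_nonneg[of f] by simp
qed

text \<open>
  Gauss's lemma. In an ordered group of exponents, take the largest exponents \<open>m\<close> of \<open>f\<close> and \<open>n\<close> of \<open>g\<close>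
  whose coefficients are not divisible by \<open>p\<close>. In the coefficient of the product at \<open>m + n\<close>, every
  other contribution is divisible by \<open>p\<close>.
\<close>

lemma prime_dvd_content_mult:
  fixes f g :: "'m::linordered_ab_group_add \<Rightarrow>\<^sub>0 int"
  assumes p: "Factorial_Ring.prime p" "p dvd content (f * g)" "\<not> p dvd content f"
  shows "p dvd content g"
proof (rule ccontr)
  assume ng: "\<not> p dvd content g"
  define F where "F = {m. \<not> p dvd lookup f m}"
  define G where "G = {m. \<not> p dvd lookup g m}"
  have FG: "F \<subseteq> keys f" "G \<subseteq> keys g" by (auto simp: F_def G_def in_keys_iff)
  then have fin: "finite F" "finite G" using finite_keys finite_subset by blast+
  have ne: "F \<noteq> {}" "G \<noteq> {}" using p(3) ng by (auto simp: F_def G_def dvd_content_iff)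
  let ?m = "Max F" and ?n = "Max G"
  have mn: "?m \<in> F" "?n \<in> G" using fin ne by auto
  let ?t = "\<lambda>(m, n). if m + n = ?m + ?n then lookup f m * lookup g n else 0"
  have other: "p dvd ?t x" if x: "x \<in> keys f \<times> keys g - {(?m, ?n)}" for x
  proof (cases x)
    case (Pair m n)
    have "m \<notin> F \<or> n \<notin> G" if "m + n = ?m + ?n"
    proof (rule ccontr)
      assume "\<not> (m \<notin> F \<or> n \<notin> G)"
      then have "m \<le> ?m" "n \<le> ?n" using fin by auto
      then have "m = ?m \<and> n = ?n" using that
        using add_less_le_mono[of m ?m n ?n] add_le_less_mono[of m ?m n ?n]
        by (auto simp: order.order_iff_strict)
      then show False using x Pair by auto
    qed
    then show ?thesis using Pair by (auto simp: F_def G_def)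
  qed
  have "lookup (f * g) (?m + ?n) = ?t (?m, ?n) + (\<Sum>x\<in>keys f \<times> keys g - {(?m, ?n)}. ?t x)"
    unfolding lookup_times using mn FG
    by (intro sum.remove) auto
  moreover have "p dvd (\<Sum>x\<in>keys f \<times> keys g - {(?m, ?n)}. ?t x)"
    using other by (intro dvd_sum) auto
  moreover have "p dvd lookup (f * g) (?m + ?n)" using p(2) by (simp add: dvd_content_iff)
  ultimately have "p dvd lookup f ?m * lookup g ?n"
    by (simp add: dvd_add_left_iff)
  then show False using mn p(1) prime_dvd_multD by (auto simp: F_def G_def)
qed

lemma primitive_mult:
  fixes f g :: "'m::linordered_ab_group_add \<Rightarrow>\<^sub>0 int"
  assumes "primitive f" "primitive g"
  shows "primitive (f * g)"
proof (rule primitiveI)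
  fix p :: int assume p: "Factorial_Ring.prime p"
  show "\<not> p dvd content (f * g)"
    using prime_dvd_content_mult[OF p, of f g] assms not_prime_unit p by auto
qed

lemma content_of_int_mult:
  fixes f :: "'m::comm_monoid_add \<Rightarrow>\<^sub>0 int"
  shows "content (of_int c * f) = \<bar>c\<bar> * content f"
proof -
  have "range (lookup (of_int c * f)) = (*) c ` range (lookup f)"
    by (auto simp: lookup_of_int_mult image_iff)
  then show ?thesis by (simp add: content_def Gcd_mult abs_mult)
qed

lemma content_factor:
  fixes f :: "'m::comm_monoid_add \<Rightarrow>\<^sub>0 int"
  assumes "n dvd content f"
  obtains f' where "f = of_int n * f'" "keys f' \<subseteq> keys f"
proof
  let ?f' = "Poly_Mapping.map (\<lambda>c. c div n) f"
  have l: "lookup ?f' m = lookup f m div n" for m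
    by (simp add: map.rep_eq when_def)
  show "f = of_int n * ?f'"
    using assms by (intro poly_mapping_eqI) (simp add: lookup_of_int_mult l dvd_content_iff)
  show "keys ?f' \<subseteq> keys f" by (auto simp: in_keys_iff l)
qed

lemma primitive_part:
  fixes f :: "'m::comm_monoid_add \<Rightarrow>\<^sub>0 int"
  assumes "f \<noteq> 0"
  obtains f' where "f = of_int (content f) * f'" "keys f' \<subseteq> keys f" "primitive f'"
proof -
  obtain f' where f': "f = of_int (content f) * f'" "keys f' \<subseteq> keys f"
    using content_factor[of "content f" f] by auto
  have "content f = \<bar>content f\<bar> * content f'"
    using content_of_int_mult[of "content f" f'] unfolding f'(1)[symmetric] .
  then have "content f = content f * content f'" using content_nonneg[of f] by simp
  then have "primitive f'" using assms content_eq_0_iff[of f] by simp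
  then show ?thesis using f' that by blast
qed

lemma dvd_content_mult_primitive:
  fixes f g :: "'m::linordered_ab_group_add \<Rightarrow>\<^sub>0 int"
  assumes "n dvd content (f * g)" "primitive g"
  shows "n dvd content f"
proof (cases "f = 0")
  case True
  then show ?thesis by (simp add: content_def)
next
  case False
  define c where "c = content f"
  obtain f' where f': "f = of_int c * f'" "primitive f'"
    using primitive_part[OF False] unfolding c_def by blast
  have "content (f * g) = content (of_int c * (f' * g))"
    by (simp add: f'(1) mult.assoc)
  also have "\<dots> = c"
    using primitive_mult[OF f'(2) assms(2)] content_nonneg[of f]
    by (simp add: content_of_int_mult c_def)
  finally have "content (f * g) = content f" by (simp add: c_def)
  then show ?thesis using assms(1) by simp
qed

text \<open>
  The map of group rings induced by a map of exponents.
\<close>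

definition push :: "('m \<Rightarrow> 'n) \<Rightarrow> ('m \<Rightarrow>\<^sub>0 int) \<Rightarrow> 'n \<Rightarrow>\<^sub>0 int" where
  "push h f = frag_extend (\<lambda>m. frag_of (h m)) f"

lemma push_add: "push h (f + g) = push h f + push h g"
  by (simp add: push_def frag_extend_add)

lemma push_diff: "push h (f - g) = push h f - push h g"
  by (simp add: push_def frag_extend_diff)

lemma push_zero: "push h 0 = 0"
  by (simp add: push_def)

lemma push_one: "h 0 = 0 \<Longrightarrow> push h 1 = 1"
  by (metis frag_extend_of push_def single_one)

lemma push_mult:
  fixes h :: "'m::comm_monoid_add \<Rightarrow> 'n::comm_monoid_add"
  assumes h: "\<And>m n. h (m + n) = h m + h n"
  shows "push h (f * g) = push h f * push h g"
proof -
  have 1: "push h (frag_of m * g) = push h (frag_of m) * push h g" for m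
  using subset_UNIV[of "keys g"]
  proof (induction g rule: frag_induction)
    case (diff a b)
    then show ?case by (simp add: right_diff_distrib push_diff)
  next
    case zero
    show ?case by (simp add: push_zero)
  next
    case (one x)
    show ?case by (simp add: mult_single push_def h)
  qed
  show ?thesis
  using subset_UNIV[of "keys f"]
  proof (induction f rule: frag_induction)
    case (diff a b)
    then show ?case by (simp add: left_diff_distrib push_diff)
  next
    case zero
    show ?case by (simp add: push_zero)
  next
    case (one x)
    show ?case by (rule 1)
  qed
qed

lemma push_ident: "(\<And>m. m \<in> keys f \<Longrightarrow> h m = m) \<Longrightarrow> push h f = f"
  using frag_extend_eq[of f "\<lambda>m. frag_of (h m)" frag_of]
  by (simp add: push_def flip: frag_expansion)

lemma keys_push: "keys (push h f) \<subseteq> h ` keys f"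
  using keys_frag_extend[of "\<lambda>m. frag_of (h m)" f] by (auto simp: push_def)

lemma lookup_push:
  assumes "inj_on h (keys f)" "m \<in> keys f"
  shows "lookup (push h f) (h m) = lookup f m"
proof -
  have "lookup (push h f) (h m) = (\<Sum>i\<in>keys f. if i = m then lookup f i else 0)"
    unfolding push_def frag_extend_def lookup_sum
    using assms by (intro sum.cong) (auto simp: inj_on_def)
  then show ?thesis using assms(2) by simp
qed

text \<open>
  A substitution that keeps the monomials of \<open>f\<close> distinct only relabels the coefficients.
\<close>

lemma primitive_push:
  assumes "inj_on h (keys f)" "primitive f"
  shows "primitive (push h f)"
proof (rule primitiveI)
  fix p :: int assume p: "Factorial_Ring.prime p"
  show "\<not> p dvd content (push h f)"
  proof
    assume "p dvd content (push h f)"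
    then have d: "p dvd lookup (push h f) k" for k by (simp add: dvd_content_iff)
    have "p dvd lookup f m" for m
      using lookup_push[OF assms(1), of m] d[of "h m"]
      by (cases "m \<in> keys f") (auto simp: in_keys_iff)
    then have "p dvd content f" by (simp add: dvd_content_iff)
    then show False using p assms(2) not_prime_unit by auto
  qed
qed

section \<open>Nagata rings\<close>

text \<open>
  Laurent polynomials in the variables \<open>W\<close>: the inner \<open>\<Rightarrow>\<^sub>0\<close> is the group of monomials, with integer
  exponents.
\<close>

definition lpoly_on :: "'v set \<Rightarrow> (('v \<Rightarrow>\<^sub>0 int) \<Rightarrow>\<^sub>0 int) set" where
  "lpoly_on W = {f. \<forall>m\<in>keys f. keys m \<subseteq> W}"

lemma lpoly_on_zero: "0 \<in> lpoly_on W"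
  by (simp add: lpoly_on_def)

lemma lpoly_on_one: "1 \<in> lpoly_on W"
  by (simp add: lpoly_on_def)

lemma lpoly_on_add: "f \<in> lpoly_on W \<Longrightarrow> g \<in> lpoly_on W \<Longrightarrow> f + g \<in> lpoly_on W"
  using keys_add[of f g] by (auto simp: lpoly_on_def)

lemma lpoly_on_minus: "f \<in> lpoly_on W \<Longrightarrow> - f \<in> lpoly_on W"
  by (simp add: lpoly_on_def)

lemma lpoly_on_mult:
  assumes "f \<in> lpoly_on W" "g \<in> lpoly_on W" shows "f * g \<in> lpoly_on W"
proof -
  have "keys m \<subseteq> W" if "m \<in> keys (f * g)" for m
  proof -
    obtain a b where "m = a + b" "a \<in> keys f" "b \<in> keys g"
      using \<open>m \<in> keys (f * g)\<close> keys_mult[of f g] by blast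
    then show ?thesis using assms keys_add[of a b] unfolding lpoly_on_def by blast
  qed
  then show ?thesis by (simp add: lpoly_on_def)
qed

lemma lpoly_on_of_int: "of_int n \<in> lpoly_on W"
proof (induction n rule: int_induct[where k = 0])
  case (step2 n)
  then show ?case using lpoly_on_add[OF _ lpoly_on_minus[OF lpoly_on_one], of "of_int n" W] by simp
qed (simp_all add: lpoly_on_zero lpoly_on_one lpoly_on_add)

lemma lpoly_on_mono: "V \<subseteq> W \<Longrightarrow> lpoly_on V \<subseteq> lpoly_on W"
  by (auto simp: lpoly_on_def)

lemma lpoly_on_push:
  assumes "f \<in> lpoly_on W" "\<And>m. keys m \<subseteq> W \<Longrightarrow> keys (h m) \<subseteq> V"
  shows "push h f \<in> lpoly_on V"
  unfolding lpoly_on_def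
proof (intro CollectI ballI)
  fix k assume "k \<in> keys (push h f)"
  then obtain m where "m \<in> keys f" "k = h m" using keys_push[of h f] by blast
  then show "keys k \<subseteq> V" using assms by (simp add: lpoly_on_def)
qed

lemma of_int_fract: "(of_int n :: 'a::idom fract) = Fract (of_int n) 1"
proof (cases n rule: int_cases2)
  case (nonneg k)
  then show ?thesis by (simp add: of_nat_fract)
next
  case (nonpos k)
  then show ?thesis by (simp add: of_nat_fract)
qed

definition nagata :: "'v::linorder set \<Rightarrow> (('v \<Rightarrow>\<^sub>0 int) \<Rightarrow>\<^sub>0 int) fract set" where
  "nagata W = {Fract f g | f g. f \<in> lpoly_on W \<and> g \<in> lpoly_on W \<and> primitive g}"

lemma nagataI: "f \<in> lpoly_on W \<Longrightarrow> g \<in> lpoly_on W \<Longrightarrow> primitive g \<Longrightarrow> Fract f g \<in> nagata W"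
  by (auto simp: nagata_def)

lemma nagataE:
  assumes "r \<in> nagata W"
  obtains f g where "r = Fract f g" "f \<in> lpoly_on W" "g \<in> lpoly_on W" "primitive g" "g \<noteq> 0"
  using assms primitive_nonzero unfolding nagata_def by blast

lemma nagata_mono: "V \<subseteq> W \<Longrightarrow> nagata V \<subseteq> nagata W"
  using lpoly_on_mono[of V W] by (auto simp: nagata_def)

lemma nagata_add: "r \<in> nagata W \<Longrightarrow> s \<in> nagata W \<Longrightarrow> r + s \<in> nagata W"
  by (elim nagataE) (simp add: nagataI lpoly_on_add lpoly_on_mult primitive_mult)

lemma nagata_mult: "r \<in> nagata W \<Longrightarrow> s \<in> nagata W \<Longrightarrow> r * s \<in> nagata W"
  by (elim nagataE) (simp add: nagataI lpoly_on_mult primitive_mult)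

lemma nagata_minus: "r \<in> nagata W \<Longrightarrow> - r \<in> nagata W"
  by (elim nagataE) (simp add: nagataI lpoly_on_minus)

lemma nagata_of_int: "of_int n \<in> nagata W"
  unfolding of_int_fract by (intro nagataI lpoly_on_of_int lpoly_on_one primitive_one)

lemma nagata_zero: "0 \<in> nagata W" and nagata_one: "1 \<in> nagata W"
  using nagata_of_int[of 0] nagata_of_int[of 1] by simp_all

lemma zsubspace_nagata: "zsubspace (nagata W)"
  by (intro zm.subspaceI) (auto intro: nagata_zero nagata_add nagata_mult nagata_of_int)

text \<open>
  The integer is the content of the numerator. Over a primitive denominator the primitive part
  of the numerator is a unit.
\<close>

lemma nagata_int_unit_factor:
  assumes "r \<in> nagata W" "r \<noteq> 0"
  obtains n u where "n > 0" "r = of_int n * u" "u \<in> nagata W" "inverse u \<in> nagata W" "u \<noteq> 0"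
proof -
  obtain f g where fg: "r = Fract f g" "f \<in> lpoly_on W" "g \<in> lpoly_on W" "primitive g" "g \<noteq> 0"
    using assms(1) by (rule nagataE)
  have f0: "f \<noteq> 0" using fg assms(2) by (auto simp: Zero_fract_def eq_fract)
  define n where "n = content f"
  obtain f' where f': "f = of_int n * f'" "keys f' \<subseteq> keys f" "primitive f'"
    using primitive_part[OF f0] unfolding n_def by blast
  have f'W: "f' \<in> lpoly_on W" using f'(2) fg(2) by (auto simp: lpoly_on_def)
  have "n > 0" using f0 content_eq_0_iff[of f] content_nonneg[of f] by (simp add: n_def)
  moreover have "r = of_int n * Fract f' g"
    by (simp add: fg(1) f'(1) of_int_fract)
  moreover have "Fract f' g \<in> nagata W" "inverse (Fract f' g) \<in> nagata W"
    using f'W f'(3) fg by (simp_all add: nagataI)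
  moreover have "Fract f' g \<noteq> 0"
    using primitive_nonzero[OF f'(3)] fg(5) by (simp add: Zero_fract_def eq_fract)
  ultimately show ?thesis using that by blast
qed

text \<open>
  If \<open>n a / b = c / g\<close> with \<open>b\<close> primitive, then \<open>n\<close> divides the content of \<open>c b\<close>, hence that of \<open>c\<close>.
\<close>

lemma pure_in_fractions_over:
  assumes "primitive g"
  shows "pure_in (range (\<lambda>f. Fract f g)) (nagata W)"
  unfolding pure_in_def
proof (intro ballI allI impI)
  fix r and n :: int
  assume "r \<in> nagata W" and n: "n \<noteq> 0" and "of_int n * r \<in> range (\<lambda>f. Fract f g)"
  then obtain a b c where ab: "r = Fract a b" "primitive b" "b \<noteq> 0"
      and c: "of_int n * r = Fract c g"
    by (auto elim: nagataE)
  have g: "g \<noteq> 0" using assms by (rule primitive_nonzero)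
  have eq: "of_int n * (a * g) = c * b"
    using c ab g by (simp add: of_int_fract eq_fract mult_ac)
  have "n dvd content (c * b)"
    unfolding eq[symmetric] content_of_int_mult by simp
  then obtain c' where c': "c = of_int n * c'"
    using dvd_content_mult_primitive[OF _ ab(2)] content_factor by metis
  have "(of_int n :: ('a \<Rightarrow>\<^sub>0 int) \<Rightarrow>\<^sub>0 int) \<noteq> 0" using n by simp
  then have "a * g = c' * b" using eq by (simp add: c' mult.assoc)
  then have "r = Fract c' g" using ab g by (simp add: eq_fract)
  then show "r \<in> range (\<lambda>f. Fract f g)" by blast
qed

lemma common_primitive_denominator:
  assumes "finite F" "F \<subseteq> nagata W"
  shows "\<exists>g. primitive g \<and> F \<subseteq> range (\<lambda>f. Fract f g)"
  using assms
proof (induction F rule: finite_induct)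
  case empty
  then show ?case using primitive_one by blast
next
  case (insert r F)
  then obtain g where g: "primitive g" "F \<subseteq> range (\<lambda>f. Fract f g)" by auto
  obtain a b where ab: "r = Fract a b" "primitive b" "b \<noteq> 0"
    using insert.prems by (auto elim: nagataE)
  have g0: "g \<noteq> 0" using g(1) by (rule primitive_nonzero)
  have "Fract f g = Fract (f * b) (g * b)" for f
    using g0 ab(3) by (simp add: eq_fract)
  moreover have "r = Fract (a * g) (g * b)"
    using g0 ab by (simp add: eq_fract)
  ultimately have "insert r F \<subseteq> range (\<lambda>f. Fract f (g * b))"
    using g(2) by (auto simp: subset_iff image_iff) 
  then show ?case using primitive_mult[OF g(1) ab(2)] by blast
qed

lemma torsionless_poly_mapping: "torsionless TYPE('m::comm_monoid_add \<Rightarrow>\<^sub>0 int)"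
  unfolding torsionless_def
proof (intro allI impI)
  fix x :: "'m \<Rightarrow>\<^sub>0 int" assume "x \<noteq> 0"
  then obtain m where "lookup x m \<noteq> 0" by (metis lookup_zero poly_mapping_eqI)
  moreover have "Modules.additive (\<lambda>x::'m \<Rightarrow>\<^sub>0 int. lookup x m)"
    by (simp add: Modules.additive_def lookup_add)
  ultimately show "\<exists>\<phi>::('m \<Rightarrow>\<^sub>0 int) \<Rightarrow> int. Modules.additive \<phi> \<and> \<phi> x \<noteq> 0" by blast
qed

text \<open>
  The pure torsionless subgroups demanded by Pontryagin's criterion are the groups of fractions
  over a fixed primitive denominator.
\<close>

lemma countable_subgroup_has_basis:
  fixes W :: "'v::linorder set"
  assumes "zsubspace A" "countable A" "A \<subseteq> nagata W"
  shows "\<exists>B. B \<subseteq> A \<and> zindependent B \<and> zspan B = A"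
proof (rule countable_group_has_basis[OF assms(1,2) torsionless_poly_mapping])
  fix F assume "finite F" "F \<subseteq> A"
  then obtain g where g: "primitive g" "F \<subseteq> range (\<lambda>f. Fract f g)"
    using common_primitive_denominator[of F W] assms(3) by auto
  have g0: "g \<noteq> 0" using g(1) by (rule primitive_nonzero)
  have "Fract (a + b) g = Fract a g + Fract b g" for a b
    using g0 by (simp add: eq_fract algebra_simps)
  then have "Modules.additive (\<lambda>f. Fract f g)" by (simp add: Modules.additive_def)
  moreover have "inj (\<lambda>f. Fract f g)" using g0 by (auto simp: inj_def eq_fract)
  moreover have "pure_in (range (\<lambda>f. Fract f g)) A"
    using pure_in_fractions_over[OF g(1), of W] assms(3) by (auto simp: pure_in_def)
  ultimately show "\<exists>\<iota>::(('v \<Rightarrow>\<^sub>0 int) \<Rightarrow>\<^sub>0 int) \<Rightarrow> (('v \<Rightarrow>\<^sub>0 int) \<Rightarrow>\<^sub>0 int) fract.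
      Modules.additive \<iota> \<and> inj \<iota> \<and> F \<subseteq> range \<iota> \<and> pure_in (range \<iota>) A"
    using g(2) by blast
qed

lemma countable_poly_mapping_on:
  assumes "countable S"
  shows "countable {f :: 'b \<Rightarrow>\<^sub>0 int. keys f \<subseteq> S}"
proof -
  let ?graph = "\<lambda>f :: 'b \<Rightarrow>\<^sub>0 int. (\<lambda>k. (k, lookup f k)) ` keys f"
  have "inj_on ?graph {f. keys f \<subseteq> S}"
  proof (intro inj_onI poly_mapping_eqI)
    fix f g :: "'b \<Rightarrow>\<^sub>0 int" and k
    assume eq: "?graph f = ?graph g"
    have "k \<in> keys f \<longleftrightarrow> k \<in> keys g"
      using arg_cong[OF eq, of "image fst"] by (simp add: image_image)
    moreover have "lookup f k = lookup g k" if "k \<in> keys f"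
    proof -
      have "(k, lookup f k) \<in> ?graph g" using that unfolding eq[symmetric] by blast
      then show ?thesis by auto
    qed
    ultimately show "lookup f k = lookup g k" by (auto simp: in_keys_iff)
  qed
  moreover have "?graph ` {f. keys f \<subseteq> S} \<subseteq> {A. finite A \<and> A \<subseteq> S \<times> UNIV}"
    by auto
  then have "countable (?graph ` {f. keys f \<subseteq> S})"
    by (rule countable_subset)
      (intro countable_Collect_finite_subset countable_SIGMA assms; simp)
  ultimately show ?thesis by (rule countable_image_inj_on[rotated])
qed

lemma nagata_subset_image:
  "nagata W \<subseteq> (\<lambda>(f, g). Fract f g) ` (lpoly_on W \<times> lpoly_on W)"
  by (auto simp: nagata_def)

lemma lpoly_on_eq: "lpoly_on W = {f. keys f \<subseteq> {m. keys m \<subseteq> W}}"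
  by (auto simp: lpoly_on_def)

lemma countable_nagata:
  assumes "countable W" shows "countable (nagata W)"
proof -
  have "countable (lpoly_on W)"
    unfolding lpoly_on_eq by (intro countable_poly_mapping_on assms)
  then show ?thesis
    using nagata_subset_image countable_subset by blast
qed

section \<open>Exchanging and eliminating variables\<close>

text \<open>
  The extension of \<^term>\<open>push h\<close> to fractions. The choice of a representing fraction is immaterial
  when \<open>h\<close> is an injective homomorphism.
\<close>

definition fract_push :: "('m::{ordered_cancel_comm_monoid_add, linorder} \<Rightarrow> 'm) \<Rightarrow>
    ('m \<Rightarrow>\<^sub>0 int) fract \<Rightarrow> ('m \<Rightarrow>\<^sub>0 int) fract" where
  "fract_push h q = (let (a, b) = SOME (a, b). q = Fract a b \<and> b \<noteq> 0 in Fract (push h a) (push h b))"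

lemma push_nonzero:
  assumes "inj_on h (keys f)" "f \<noteq> 0" shows "push h f \<noteq> 0"
proof -
  obtain m where "m \<in> keys f" using assms(2) by fastforce
  then have "lookup (push h f) (h m) \<noteq> 0"
    using lookup_push[OF assms(1)] by (simp add: in_keys_iff)
  then show ?thesis by auto
qed

lemma fract_push_Fract:
  fixes h :: "'m::{ordered_cancel_comm_monoid_add, linorder} \<Rightarrow> 'm"
  assumes h: "\<And>m n. h (m + n) = h m + h n" "inj h" and b: "b \<noteq> 0"
  shows "fract_push h (Fract a b) = Fract (push h a) (push h b)"
proof -
  let ?P = "\<lambda>(a', b'). Fract a b = Fract a' b' \<and> b' \<noteq> 0"
  have nz: "push h f \<noteq> 0" if "f \<noteq> 0" for f
    using push_nonzero[OF inj_on_subset[OF h(2) subset_UNIV] that] .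
  obtain a' b' where ab: "(SOME x. ?P x) = (a', b')" by (cases "SOME x. ?P x")
  have "?P (a, b)" using b by simp
  then have "?P (SOME x. ?P x)" by (rule someI)
  then have e: "Fract a b = Fract a' b'" "b' \<noteq> 0" unfolding ab by auto
  then have "a * b' = a' * b" using b by (simp add: eq_fract)
  then have "push h a * push h b' = push h a' * push h b"
    using push_mult[of h, OF h(1)] by metis
  then have "Fract (push h a') (push h b') = Fract (push h a) (push h b)"
    using nz b e(2) by (simp add: eq_fract)
  then show ?thesis unfolding fract_push_def ab by simp
qed

lemma additive_fract_push:
  fixes h :: "'m::{ordered_cancel_comm_monoid_add, linorder} \<Rightarrow> 'm"
  assumes h: "\<And>m n. h (m + n) = h m + h n" "inj h"
  shows "Modules.additive (fract_push h)"
proof (rule Modules.additive.intro)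
  fix x y :: "('m \<Rightarrow>\<^sub>0 int) fract"
  have nz: "push h f \<noteq> 0" if "f \<noteq> 0" for f
    using push_nonzero[OF inj_on_subset[OF h(2) subset_UNIV] that] .
  show "fract_push h (x + y) = fract_push h x + fract_push h y"
    by (cases x; cases y) (simp add: fract_push_Fract[OF h] nz push_add push_mult[of h, OF h(1)])
qed

definition swap_mon :: "'v \<Rightarrow> 'v \<Rightarrow> ('v \<Rightarrow>\<^sub>0 int) \<Rightarrow> 'v \<Rightarrow>\<^sub>0 int" where
  "swap_mon u v = Poly_Mapping.map_key (transpose u v)"

lemma lookup_swap_mon: "lookup (swap_mon u v m) i = lookup m (transpose u v i)"
  by (simp add: swap_mon_def map_key.rep_eq inj_transpose)

lemma swap_mon_add: "swap_mon u v (m + n) = swap_mon u v m + swap_mon u v n"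
  by (intro poly_mapping_eqI) (simp add: lookup_swap_mon lookup_add)

lemma swap_mon_swap_mon: "swap_mon u v (swap_mon u v m) = m"
  by (intro poly_mapping_eqI) (simp add: lookup_swap_mon)

lemma inj_swap_mon: "inj (swap_mon u v)"
  by (metis injI swap_mon_swap_mon)

lemma keys_swap_mon: "keys (swap_mon u v m) = transpose u v ` keys m"
proof -
  have "i \<in> keys (swap_mon u v m) \<longleftrightarrow> transpose u v i \<in> keys m" for i
    by (simp add: in_keys_iff lookup_swap_mon)
  moreover have "i \<in> transpose u v ` keys m" if "transpose u v i \<in> keys m" for i
    using that by (intro image_eqI[of _ _ "transpose u v i"]) simp_all
  ultimately show ?thesis by auto
qed

lemma swap_mon_ident:
  assumes "u \<notin> keys m" "v \<notin> keys m" shows "swap_mon u v m = m"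
proof (rule poly_mapping_eqI)
  fix i show "lookup (swap_mon u v m) i = lookup m i"
    using assms by (auto simp: lookup_swap_mon transpose_def in_keys_iff)
qed

definition swap_vars :: "'v::linorder \<Rightarrow> 'v \<Rightarrow> (('v \<Rightarrow>\<^sub>0 int) \<Rightarrow>\<^sub>0 int) fract \<Rightarrow> (('v \<Rightarrow>\<^sub>0 int) \<Rightarrow>\<^sub>0 int) fract" where
  "swap_vars u v = fract_push (swap_mon u v)"

lemma additive_swap_vars: "Modules.additive (swap_vars u v)"
  unfolding swap_vars_def by (intro additive_fract_push swap_mon_add inj_swap_mon)

lemma swap_vars_nagata:
  assumes "r \<in> nagata W" shows "swap_vars u v r \<in> nagata (transpose u v ` W)"
proof -
  obtain f g where fg: "r = Fract f g" "f \<in> lpoly_on W" "g \<in> lpoly_on W" "primitive g" "g \<noteq> 0"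
    using assms by (rule nagataE)
  have "swap_vars u v r = Fract (push (swap_mon u v) f) (push (swap_mon u v) g)"
    unfolding swap_vars_def fg(1) by (intro fract_push_Fract swap_mon_add inj_swap_mon fg)
  moreover have "primitive (push (swap_mon u v) g)"
    using inj_on_subset[OF inj_swap_mon subset_UNIV] fg(4) by (rule primitive_push)
  ultimately show ?thesis
    using fg(2,3) by (auto intro!: nagataI imageI elim!: lpoly_on_push simp: keys_swap_mon)
qed

lemma swap_vars_ident:
  assumes "r \<in> nagata W" "u \<notin> W" "v \<notin> W" shows "swap_vars u v r = r"
proof -
  obtain f g where fg: "r = Fract f g" "f \<in> lpoly_on W" "g \<in> lpoly_on W" "primitive g" "g \<noteq> 0"
    using assms(1) by (rule nagataE)
  have *: "push (swap_mon u v) f = f" if "f \<in> lpoly_on W" for f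
    using that assms(2,3) by (intro push_ident swap_mon_ident) (auto simp: lpoly_on_def)
  have "swap_vars u v r = Fract (push (swap_mon u v) f) (push (swap_mon u v) g)"
    unfolding swap_vars_def fg(1) by (intro fract_push_Fract swap_mon_add inj_swap_mon fg)
  then show ?thesis using * fg by simp
qed

text \<open>
  The substitution \<open>z := y\<^sup>N\<close> on monomials.
\<close>

definition subst_mon :: "'v \<Rightarrow> 'v \<Rightarrow> int \<Rightarrow> ('v \<Rightarrow>\<^sub>0 int) \<Rightarrow> 'v \<Rightarrow>\<^sub>0 int" where
  "subst_mon z y N m =
    m + Poly_Mapping.single y (N * lookup m z) - Poly_Mapping.single z (lookup m z)"

lemma lookup_subst_mon:
  assumes "y \<noteq> z"
  shows "lookup (subst_mon z y N m) i =
    (if i = z then 0 else if i = y then lookup m y + N * lookup m z else lookup m i)"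
  using assms by (auto simp: subst_mon_def lookup_add lookup_minus lookup_single when_def)

lemma subst_mon_add: "subst_mon z y N (m + n) = subst_mon z y N m + subst_mon z y N n"
  by (simp add: subst_mon_def lookup_add distrib_left single_add)

lemma subst_mon_ident: "z \<notin> keys m \<Longrightarrow> subst_mon z y N m = m"
  by (simp add: subst_mon_def in_keys_iff)

lemma keys_subst_mon: "y \<noteq> z \<Longrightarrow> keys (subst_mon z y N m) \<subseteq> insert y (keys m - {z})"
  by (auto simp: in_keys_iff lookup_subst_mon split: if_splits)

text \<open>
  If two monomials agree after substitution, their \<open>y\<close>-exponents differ by \<open>N\<close> times the difference
  of their \<open>z\<close>-exponents. This forces equality once \<open>N\<close> exceeds every difference of \<open>y\<close>-exponents
  in \<open>S\<close>.
\<close>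

lemma inj_on_subst_mon:
  assumes "finite S" "y \<noteq> z"
  shows "\<exists>N. inj_on (subst_mon z y N) S"
proof -
  \<comment> \<open>any bound for the differences of \<open>y\<close>-exponents; the sum saves treating empty \<open>S\<close> apart\<close>
  define N where "N = 1 + (\<Sum>(m, n)\<in>S \<times> S. \<bar>lookup m y - lookup n y\<bar>)"
  have "m = n" if mn: "m \<in> S" "n \<in> S" "subst_mon z y N m = subst_mon z y N n" for m n
  proof -
    have l: "lookup (subst_mon z y N m) i = lookup (subst_mon z y N n) i" for i
      using mn(3) by simp
    have "\<bar>lookup m y - lookup n y\<bar> < N"
    proof -
      let ?d = "\<lambda>(m, n). \<bar>lookup m y - lookup n y\<bar>"
      have "?d (m, n) \<le> sum ?d (S \<times> S)"
        using assms(1) mn(1,2) member_le_sum[of "(m, n)" "S \<times> S" ?d] by auto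
      then show ?thesis by (simp add: N_def)
    qed
    moreover have "lookup m y - lookup n y = N * (lookup n z - lookup m z)"
      using l[of y] assms(2) by (simp add: lookup_subst_mon algebra_simps)
    ultimately have small: "\<bar>N * (lookup n z - lookup m z)\<bar> < N" by simp
    have "lookup m z = lookup n z"
    proof (rule ccontr)
      assume "lookup m z \<noteq> lookup n z"
      then have "N * 1 \<le> N * \<bar>lookup n z - lookup m z\<bar>"
        using small by (intro mult_left_mono) auto
      moreover have "N > 0" using abs_ge_zero small by (rule le_less_trans)
      ultimately show False using small by (simp add: abs_mult)
    qed
    then show ?thesis
      using l assms(2) by (intro poly_mapping_eqI) (metis add_right_cancel lookup_subst_mon)
  qed
  then show ?thesis by (auto simp: inj_on_def)
qed

text \<open>
  The map induced on fractions by a non-injective \<open>h\<close> is only partially defined: it makes sense as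
  long as the denominators are not sent to \<open>0\<close>. Within this domain it is additive, as the common
  denominator \<open>G\<close> shows.
\<close>

lemma sum_Fract_push:
  fixes h :: "'m::{ordered_cancel_comm_monoid_add, linorder} \<Rightarrow> 'm"
  assumes h: "\<And>m n. h (m + n) = h m + h n" "h 0 = 0"
    and "finite I" "\<And>i. i \<in> I \<Longrightarrow> g i \<noteq> 0" "\<And>i. i \<in> I \<Longrightarrow> push h (g i) \<noteq> 0"
  shows "\<exists>F G. (\<Sum>i\<in>I. Fract (f i) (g i)) = Fract F G \<and> G \<noteq> 0 \<and> push h G \<noteq> 0 \<and>
    (\<Sum>i\<in>I. Fract (push h (f i)) (push h (g i))) = Fract (push h F) (push h G)"
  using assms(3-5)
proof (induction I rule: finite_induct)
  case empty
  show ?case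
    by (intro exI[of _ 0] exI[of _ 1]) (simp add: push_zero push_one h Zero_fract_def)
next
  case (insert i I)
  then obtain F G where FG: "(\<Sum>i\<in>I. Fract (f i) (g i)) = Fract F G" "G \<noteq> 0" "push h G \<noteq> 0"
      "(\<Sum>i\<in>I. Fract (push h (f i)) (push h (g i))) = Fract (push h F) (push h G)"
    by auto
  show ?case
    using insert FG
    by (intro exI[of _ "f i * G + F * g i"] exI[of _ "g i * G"])
      (simp add: push_add push_mult[of h, OF h(1)])
qed

text \<open>
  Substitute a high power of \<open>y\<close> for \<open>z\<close> in the whole equation. The left-hand side does not involve
  \<open>z\<close>, and the denominators on the right remain primitive.
\<close>

lemma eliminate_variable:
  fixes z y :: "'v::linorder"
  assumes "finite I" "y \<noteq> z" "r \<in> nagata W" "z \<notin> W" "r = sum u I"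
    and u: "\<And>i. i \<in> I \<Longrightarrow> u i \<in> nagata (Q i)"
  shows "\<exists>u'. r = sum u' I \<and> (\<forall>i\<in>I. u' i \<in> nagata (insert y (Q i - {z})))"
proof -
  obtain f g where fg: "r = Fract f g" "f \<in> lpoly_on W" "g \<in> lpoly_on W" "g \<noteq> 0"
    using assms(3) by (rule nagataE)
  have "\<forall>i\<in>I. \<exists>p. u i = Fract (fst p) (snd p) \<and> fst p \<in> lpoly_on (Q i) \<and>
      snd p \<in> lpoly_on (Q i) \<and> primitive (snd p)"
    using u by (fastforce simp: nagata_def)
  from bchoice[OF this] obtain p where p: "\<forall>i\<in>I. u i = Fract (fst (p i)) (snd (p i)) \<and>
      fst (p i) \<in> lpoly_on (Q i) \<and> snd (p i) \<in> lpoly_on (Q i) \<and> primitive (snd (p i))" ..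
  define a b where "a i = fst (p i)" and "b i = snd (p i)" for i
  have ab: "\<And>i. i \<in> I \<Longrightarrow> u i = Fract (a i) (b i)"
      "\<And>i. i \<in> I \<Longrightarrow> a i \<in> lpoly_on (Q i)" "\<And>i. i \<in> I \<Longrightarrow> b i \<in> lpoly_on (Q i)"
      "\<And>i. i \<in> I \<Longrightarrow> primitive (b i)"
    using p by (simp_all add: a_def b_def)
  obtain N where N: "inj_on (subst_mon z y N) (\<Union>i\<in>I. keys (b i))"
    using inj_on_subst_mon[of "\<Union>i\<in>I. keys (b i)" y z] assms(1,2) by auto
  let ?h = "push (subst_mon z y N)"
  have prim: "primitive (?h (b i))" if "i \<in> I" for i
    using that N ab(4) by (intro primitive_push inj_on_subset[OF N]) auto
  have fixed: "?h p = p" if "p \<in> lpoly_on W" for p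
    using that assms(4) by (intro push_ident subst_mon_ident) (auto simp: lpoly_on_def)
  obtain F G where FG: "(\<Sum>i\<in>I. Fract (a i) (b i)) = Fract F G" "G \<noteq> 0" "?h G \<noteq> 0"
      "(\<Sum>i\<in>I. Fract (?h (a i)) (?h (b i))) = Fract (?h F) (?h G)"
    using sum_Fract_push[of "subst_mon z y N" I b a] assms(1) ab(4) prim primitive_nonzero
    by (metis (no_types, lifting) subst_mon_add subst_mon_ident empty_iff keys_zero)
  have "Fract f g = Fract F G" using assms(5) ab(1) fg(1) FG(1) by simp
  then have "f * G = F * g" using fg(4) FG(2) by (simp add: eq_fract)
  then have "?h f * ?h G = ?h F * ?h g"
    using push_mult[of "subst_mon z y N", OF subst_mon_add] by metis
  then have "r = Fract (?h F) (?h G)" using fg FG(3) by (simp add: eq_fract fixed)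
  then have "r = (\<Sum>i\<in>I. Fract (?h (a i)) (?h (b i)))" using FG(4) by simp
  moreover have "Fract (?h (a i)) (?h (b i)) \<in> nagata (insert y (Q i - {z}))" if "i \<in> I" for i
  proof (intro nagataI prim that)
    have *: "keys (subst_mon z y N m) \<subseteq> insert y (Q i - {z})" if "keys m \<subseteq> Q i" for m
      using keys_subst_mon[OF assms(2), of N m] that by blast
    show "?h (a i) \<in> lpoly_on (insert y (Q i - {z}))" "?h (b i) \<in> lpoly_on (insert y (Q i - {z}))"
      using ab(2,3) that * lpoly_on_push by blast+
  qed
  ultimately show ?thesis by blast
qed

lemma eliminate_variables:
  fixes y :: "'v::linorder"
  assumes "finite I" "finite Z" "y \<notin> Z" "r \<in> nagata W" "W \<inter> Z = {}" "r = sum u I"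
    and u: "\<And>i. i \<in> I \<Longrightarrow> u i \<in> nagata (Q i)"
  shows "\<exists>u'. r = sum u' I \<and> (\<forall>i\<in>I. u' i \<in> nagata (insert y (Q i - Z)))"
  using assms(2,3,5)
proof (induction Z rule: finite_induct)
  case empty
  have "nagata (Q i) \<subseteq> nagata (insert y (Q i))" for i by (intro nagata_mono) blast
  then show ?case using assms(6) u by auto
next
  case (insert z Z)
  then obtain u' where u': "r = sum u' I" "\<forall>i\<in>I. u' i \<in> nagata (insert y (Q i - Z))" by auto
  have "\<exists>u''. r = sum u'' I \<and> (\<forall>i\<in>I. u'' i \<in> nagata (insert y (insert y (Q i - Z) - {z})))"
    using insert.prems u' assms(1,4) by (intro eliminate_variable[of I y z r W u']) auto
  moreover have "insert y (insert y (Q i - Z) - {z}) = insert y (Q i - insert z Z)" for i by auto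
  ultimately show ?case by simp
qed

section \<open>A basis of the Nagata ring\<close>

text \<open>
  \<open>Base\<close> is the variable whose powers replace eliminated ones; \<open>Copy x\<close> is the partner of \<open>Var x\<close>.
\<close>

datatype 'a var = Base | Var 'a | Copy 'a

text \<open>
  A linear order on the variables orders the group of monomials, so that Laurent polynomials form
  an integral domain and Gauss's lemma applies. A well-order serves, as it exists on every type.
\<close>

definition var_well_order :: "'a var rel" where
  "var_well_order = (SOME r. Well_order r \<and> Field r = UNIV)"

lemma var_well_order:
  "Well_order (var_well_order :: 'a var rel) \<and> Field (var_well_order :: 'a var rel) = UNIV"
  unfolding var_well_order_def by (rule someI_ex[OF well_ordering])

instantiation var :: (type) linorder
begin

definition less_eq_var :: "'a var \<Rightarrow> 'a var \<Rightarrow> bool" where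
  "less_eq_var u v \<longleftrightarrow> (u, v) \<in> var_well_order"

definition less_var :: "'a var \<Rightarrow> 'a var \<Rightarrow> bool" where
  "less_var u v \<longleftrightarrow> u \<le> v \<and> \<not> v \<le> u"

instance
proof
  fix u v w :: "'a var"
  have "linear_order (var_well_order :: 'a var rel)"
    using var_well_order[where 'a = 'a] by (metis well_order_on_def)
  then have rta: "refl (var_well_order :: 'a var rel)" "trans (var_well_order :: 'a var rel)"
      "antisym (var_well_order :: 'a var rel)" "total (var_well_order :: 'a var rel)"
    by (simp_all add: linear_order_on_def partial_order_on_def preorder_on_def)
  show "u < v \<longleftrightarrow> u \<le> v \<and> \<not> v \<le> u" by (simp add: less_var_def)
  show "u \<le> u" using rta(1) by (auto simp: less_eq_var_def refl_on_def)
  show "u \<le> v \<Longrightarrow> v \<le> w \<Longrightarrow> u \<le> w" using rta(2) by (auto simp: less_eq_var_def dest: transD)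
  show "u \<le> v \<Longrightarrow> v \<le> u \<Longrightarrow> u = v" using rta(3) by (auto simp: less_eq_var_def dest: antisymD)
  show "u \<le> v \<or> v \<le> u" using rta(1,4)
    by (cases "u = v") (auto simp: less_eq_var_def total_on_def refl_on_def)
qed

end

text \<open>
  The ring called \<open>R\<^sub>P\<close> above is \<open>nagata_vars P {}\<close>. The second argument admits copies.
\<close>

definition nagata_vars :: "'a set \<Rightarrow> 'a set \<Rightarrow> (('a var \<Rightarrow>\<^sub>0 int) \<Rightarrow>\<^sub>0 int) fract set" where
  "nagata_vars P Q = nagata (insert Base (Var ` P \<union> Copy ` Q))"

lemma nagata_vars_mono: "P \<subseteq> P' \<Longrightarrow> Q \<subseteq> Q' \<Longrightarrow> nagata_vars P Q \<subseteq> nagata_vars P' Q'"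
  unfolding nagata_vars_def by (intro nagata_mono) auto

lemma zsubspace_nagata_vars: "zsubspace (nagata_vars P Q)"
  unfolding nagata_vars_def by (rule zsubspace_nagata)

text \<open>
  The operator is the product of \<open>1 - \<sigma>\<^sub>x\<close> over \<open>x\<close> in \<open>P\<close>, where \<open>\<sigma>\<^sub>x\<close> exchanges \<open>Var x\<close> and \<open>Copy x\<close>. The
  factor \<open>1 - \<sigma>\<^sub>x\<close> kills everything not involving \<open>x\<close> and its copy; and \<open>\<sigma>\<^sub>x\<close> turns any element not
  involving \<open>Copy x\<close> into one not involving \<open>Var x\<close>, which gives the summands \<open>u x\<close>.
\<close>

lemma difference_operator:
  fixes P :: "'a set"
  assumes "finite P"
  shows "\<exists>D. Modules.additive D \<and> (\<forall>Q. \<forall>r\<in>nagata_vars Q {}. D r \<in> nagata_vars Q P \<and> (\<not> P \<subseteq> Q \<longrightarrow> D r = 0) \<and>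
    (\<exists>u. D r = r + sum u P \<and> (\<forall>x\<in>P. u x \<in> nagata_vars (Q - {x}) P)))"
  using assms
proof (induction P rule: finite_induct)
  case empty
  show ?case by (intro exI[of _ id]) (simp add: Modules.additive_def)
next
  case (insert x P)
  then obtain D where D: "Modules.additive D" "\<forall>Q. \<forall>r\<in>nagata_vars Q {}. D r \<in> nagata_vars Q P \<and>
      (\<not> P \<subseteq> Q \<longrightarrow> D r = 0) \<and> (\<exists>u. D r = r + sum u P \<and> (\<forall>x\<in>P. u x \<in> nagata_vars (Q - {x}) P))"
    by blast
  let ?s = "swap_vars (Var x) (Copy x)"
  let ?D = "\<lambda>r. D r - ?s (D r)"
  have s: "?s r \<in> nagata_vars (Q - {x}) (insert x P)" if "r \<in> nagata_vars Q P" for r Q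
  proof -
    have "transpose (Var x) (Copy x) ` insert Base (Var ` Q \<union> Copy ` P) \<subseteq>
        insert Base (Var ` (Q - {x}) \<union> Copy ` insert x P)"
      using insert.hyps(2) by (auto simp: transpose_def)
    then show ?thesis
      using swap_vars_nagata[OF that[unfolded nagata_vars_def], of "Var x" "Copy x"] nagata_mono
      unfolding nagata_vars_def by blast
  qed
  have "Modules.additive ?D"
    using D(1) additive_swap_vars[of "Var x" "Copy x"] by (simp add: Modules.additive_def)
  moreover have "?D r \<in> nagata_vars Q (insert x P) \<and> (\<not> insert x P \<subseteq> Q \<longrightarrow> ?D r = 0) \<and>
      (\<exists>u. ?D r = r + sum u (insert x P) \<and> (\<forall>y\<in>insert x P. u y \<in> nagata_vars (Q - {y}) (insert x P)))"
    if r: "r \<in> nagata_vars Q {}" for r Q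
  proof (intro conjI impI)
    have DQ: "D r \<in> nagata_vars Q P" using D(2) r by blast
    note sD = s[OF DQ]
    show "?D r \<in> nagata_vars Q (insert x P)"
      using DQ sD nagata_vars_mono[of "Q - {x}" Q "insert x P" "insert x P"] nagata_vars_mono[of Q Q P "insert x P"]
      by (intro zm.subspace_diff[OF zsubspace_nagata_vars]) auto
    show "?D r = 0" if "\<not> insert x P \<subseteq> Q"
    proof (cases "P \<subseteq> Q")
      case True
      then have "x \<notin> Q" using that by blast
      then have "?s (D r) = D r"
        using insert.hyps(2) by (intro swap_vars_ident[OF DQ[unfolded nagata_vars_def]]) auto
      then show ?thesis by simp
    next
      case False
      then have "D r = 0" using D(2) r by blast
      then show ?thesis using additive_swap_vars[of "Var x" "Copy x"]
        by (simp add: Modules.additive.zero)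
    qed
    obtain u where u: "D r = r + sum u P" "\<forall>y\<in>P. u y \<in> nagata_vars (Q - {y}) P"
      using D(2) r by blast
    \<comment> \<open>the new factor contributes the one summand avoiding \<open>Var x\<close>\<close>
    let ?u = "u(x := - ?s (D r))"
    have "sum ?u P = sum u P"
      using insert.hyps(2) by (intro sum.cong) auto
    then have "?D r = r + sum ?u (insert x P)"
      using insert.hyps u(1) by simp
    moreover have "?u y \<in> nagata_vars (Q - {y}) (insert x P)" if "y \<in> insert x P" for y
    proof (cases "y = x")
      case True
      then show ?thesis using zm.subspace_neg[OF zsubspace_nagata_vars sD] by simp
    next
      case False
      then have "u y \<in> nagata_vars (Q - {y}) P" using u(2) that by blast
      then show ?thesis using False nagata_vars_mono[of "Q - {y}" "Q - {y}" P "insert x P"] by auto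
    qed
    ultimately show "\<exists>u. ?D r = r + sum u (insert x P) \<and>
        (\<forall>y\<in>insert x P. u y \<in> nagata_vars (Q - {y}) (insert x P))" by blast
  qed
  ultimately show ?case by (intro exI[of _ ?D]) blast
qed

definition diff_op :: "'a set \<Rightarrow> (('a var \<Rightarrow>\<^sub>0 int) \<Rightarrow>\<^sub>0 int) fract \<Rightarrow> (('a var \<Rightarrow>\<^sub>0 int) \<Rightarrow>\<^sub>0 int) fract" where
  "diff_op P = (SOME D. Modules.additive D \<and> (\<forall>Q. \<forall>r\<in>nagata_vars Q {}. D r \<in> nagata_vars Q P \<and> (\<not> P \<subseteq> Q \<longrightarrow> D r = 0) \<and>
    (\<exists>u. D r = r + sum u P \<and> (\<forall>x\<in>P. u x \<in> nagata_vars (Q - {x}) P))))"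

lemma
  assumes "finite P"
  shows additive_diff_op: "Modules.additive (diff_op P)"
    and diff_op_in: "r \<in> nagata_vars Q {} \<Longrightarrow> diff_op P r \<in> nagata_vars Q P"
    and diff_op_eq_0: "r \<in> nagata_vars Q {} \<Longrightarrow> \<not> P \<subseteq> Q \<Longrightarrow> diff_op P r = 0"
    and diff_op_expand: "r \<in> nagata_vars Q {} \<Longrightarrow>
      \<exists>u. diff_op P r = r + sum u P \<and> (\<forall>x\<in>P. u x \<in> nagata_vars (Q - {x}) P)"
  using someI_ex[OF difference_operator[OF assms]] unfolding diff_op_def by blast+

text \<open>
  If \<open>D\<^sub>P r = 0\<close>, the expansion of \<open>D\<^sub>P r\<close> exhibits \<open>r\<close> as a sum of elements each avoiding some \<open>x\<close> in
  \<open>P\<close>. Since \<open>r\<close> involves no copies, they can be eliminated from the summands.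
\<close>

lemma diff_op_kernel:
  assumes "finite P" "r \<in> nagata_vars P {}" "diff_op P r = 0"
  shows "\<exists>v. r = sum v P \<and> (\<forall>x\<in>P. v x \<in> nagata_vars (P - {x}) {})"
proof -
  obtain u where u: "r + sum u P = 0" "\<forall>x\<in>P. u x \<in> nagata_vars (P - {x}) P"
    using diff_op_expand[OF assms(1,2)] assms(3) by auto
  have r: "r = sum (\<lambda>x. - u x) P"
    using u(1) by (simp add: sum_negf eq_neg_iff_add_eq_0)
  have "- u x \<in> nagata (insert Base (Var ` (P - {x}) \<union> Copy ` P))" if "x \<in> P" for x
    using u(2) that zm.subspace_neg[OF zsubspace_nagata_vars] unfolding nagata_vars_def by blast
  then have "\<exists>v. r = sum v P \<and> (\<forall>x\<in>P. v x \<in>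
      nagata (insert Base (insert Base (Var ` (P - {x}) \<union> Copy ` P) - Copy ` P)))"
    using assms r by (intro eliminate_variables[of P "Copy ` P" Base r
        "insert Base (Var ` P)" "\<lambda>x. - u x"]) (auto simp: nagata_vars_def)
  moreover have "insert Base (insert Base (Var ` (P - {x}) \<union> Copy ` P) - Copy ` P) =
      insert Base (Var ` (P - {x}) \<union> Copy ` {})" for x by auto
  ultimately show ?thesis by (simp add: nagata_vars_def)
qed

text \<open>
  The image of \<open>R\<^sub>P\<close> under \<open>D\<^sub>P\<close> is a subgroup of a Nagata ring in finitely many variables, hence
  countable, and has a basis by Pontryagin's criterion. The set \<open>B\<close> lifts that basis.
\<close>

lemma basis_modulo_kernel:
  assumes "finite P"
  shows "\<exists>B. B \<subseteq> nagata_vars P {} \<and> inj_on (diff_op P) B \<and> zindependent (diff_op P ` B) \<and>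
    diff_op P ` nagata_vars P {} = diff_op P ` zspan B"
proof -
  let ?A = "diff_op P ` nagata_vars P {}"
  have "zspan (nagata_vars P {}) = nagata_vars P {}" using zsubspace_nagata_vars zm.span_eq_iff by blast
  then have sub: "zsubspace ?A"
    using additive_zspan_image[OF additive_diff_op[OF assms], of "nagata_vars P {}"] zm.subspace_span by metis
  have in_nagata_vars: "?A \<subseteq> nagata_vars P P" using diff_op_in[OF assms] by blast
  have "countable (nagata_vars P P)"
    unfolding nagata_vars_def using assms
    by (intro countable_nagata countable_finite) auto
  then have "countable ?A" using in_nagata_vars by (rule countable_subset[rotated])
  moreover have "?A \<subseteq> nagata (insert Base (Var ` P \<union> Copy ` P))"
    using in_nagata_vars unfolding nagata_vars_def[of P P] .
  ultimately have "\<exists>C. C \<subseteq> ?A \<and> zindependent C \<and> zspan C = ?A"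
    by (rule countable_subgroup_has_basis[OF sub])
  then obtain C where C: "C \<subseteq> ?A" "zindependent C" "zspan C = ?A" by (elim exE conjE)
  obtain B where B: "B \<subseteq> nagata_vars P {}" "inj_on (diff_op P) B" "C = diff_op P ` B"
    using C(1) by (meson subset_image_inj)
  have "?A = diff_op P ` zspan B"
    using C(3) additive_zspan_image[OF additive_diff_op[OF assms], of B] unfolding B(3) by simp
  then show ?thesis using B C(2) by (intro exI[of _ B]) simp
qed

definition level_basis :: "'a set \<Rightarrow> (('a var \<Rightarrow>\<^sub>0 int) \<Rightarrow>\<^sub>0 int) fract set" where
  "level_basis P = (SOME B. B \<subseteq> nagata_vars P {} \<and> inj_on (diff_op P) B \<and> zindependent (diff_op P ` B) \<and>
    diff_op P ` nagata_vars P {} = diff_op P ` zspan B)"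

lemma
  assumes "finite P"
  shows level_basis_in: "level_basis P \<subseteq> nagata_vars P {}"
    and inj_on_level_basis: "inj_on (diff_op P) (level_basis P)"
    and zindependent_level_basis: "zindependent (diff_op P ` level_basis P)"
    and level_basis_span: "diff_op P ` nagata_vars P {} = diff_op P ` zspan (level_basis P)"
  using someI_ex[OF basis_modulo_kernel[OF assms]] unfolding level_basis_def by blast+

definition nagata_basis :: "'a set \<Rightarrow> (('a var \<Rightarrow>\<^sub>0 int) \<Rightarrow>\<^sub>0 int) fract set" where
  "nagata_basis S = \<Union> (level_basis ` {P. finite P \<and> P \<subseteq> S})"

text \<open>
  An element of \<open>R\<^sub>P\<close> agrees with a combination of the basis elements of level \<open>P\<close> up to the kernel
  of \<open>D\<^sub>P\<close>, and the kernel is covered by smaller sets of variables.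
\<close>

lemma nagata_basis_spans_finite:
  assumes "finite P"
  shows "P \<subseteq> S \<Longrightarrow> nagata_vars P {} \<subseteq> zspan (nagata_basis S)"
  using assms
proof (induction P rule: finite_psubset_induct)
  case (psubset P)
  show ?case
  proof
    fix r assume r: "r \<in> nagata_vars P {}"
    then obtain s where s: "s \<in> zspan (level_basis P)" "diff_op P r = diff_op P s"
      using level_basis_span[OF psubset.hyps] by blast
    have "s \<in> nagata_vars P {}"
      using s(1) zm.span_minimal[OF level_basis_in[OF psubset.hyps] zsubspace_nagata_vars] by blast
    then have "r - s \<in> nagata_vars P {}" using r zm.subspace_diff[OF zsubspace_nagata_vars] by blast
    moreover have "diff_op P (r - s) = 0"
      using s(2) by (simp add: Modules.additive.diff[OF additive_diff_op[OF psubset.hyps]])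
    ultimately obtain v where v: "r - s = sum v P" "\<forall>x\<in>P. v x \<in> nagata_vars (P - {x}) {}"
      using diff_op_kernel[OF psubset.hyps] by blast
    have "v x \<in> zspan (nagata_basis S)" if "x \<in> P" for x
      using psubset.IH[of "P - {x}"] that v(2) psubset.prems by blast
    then have "r - s \<in> zspan (nagata_basis S)" unfolding v(1) by (rule zm.span_sum)
    moreover have "s \<in> zspan (nagata_basis S)"
    proof -
      have "level_basis P \<subseteq> nagata_basis S"
        using psubset.hyps psubset.prems by (auto simp: nagata_basis_def)
      then show ?thesis using s(1) zm.span_mono by blast
    qed
    ultimately have "(r - s) + s \<in> zspan (nagata_basis S)" by (rule zm.span_add)
    then show "r \<in> zspan (nagata_basis S)" by simp
  qed
qed

lemma lpoly_on_finite_support: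
  assumes "f \<in> lpoly_on W" "g \<in> lpoly_on W"
  shows "\<exists>V. finite V \<and> V \<subseteq> W \<and> f \<in> lpoly_on V \<and> g \<in> lpoly_on V"
  using assms
  by (intro exI[of _ "\<Union>m\<in>keys f \<union> keys g. keys m"]) (auto simp: lpoly_on_def)

lemma nagata_vars_finite_support:
  assumes "r \<in> nagata_vars S {}"
  shows "\<exists>P. finite P \<and> P \<subseteq> S \<and> r \<in> nagata_vars P {}"
proof -
  obtain f g where fg: "r = Fract f g" "f \<in> lpoly_on (insert Base (Var ` S))"
      "g \<in> lpoly_on (insert Base (Var ` S))" "primitive g"
    using assms by (auto simp: nagata_vars_def elim: nagataE)
  obtain V where V: "finite V" "V \<subseteq> insert Base (Var ` S)" "f \<in> lpoly_on V" "g \<in> lpoly_on V"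
    using lpoly_on_finite_support[OF fg(2,3)] by blast
  define P where "P = {x \<in> S. Var x \<in> V}"
  have "finite P"
    using finite_imageD[of Var P] finite_subset[OF _ V(1), of "Var ` P"]
    by (auto simp: P_def inj_on_def)
  moreover have "V \<subseteq> insert Base (Var ` P \<union> Copy ` {})" using V(2) by (auto simp: P_def)
  then have "r \<in> nagata_vars P {}"
    using nagata_mono nagataI[OF V(3,4) fg(4)] unfolding nagata_vars_def fg(1) by blast
  ultimately show ?thesis by (intro exI[of _ P]) (auto simp: P_def)
qed

lemma nagata_basis_in: "nagata_basis S \<subseteq> nagata_vars S {}"
  unfolding nagata_basis_def using level_basis_in nagata_vars_mono[of _ S "{}" "{}"] by blast

lemma zspan_nagata_basis: "zspan (nagata_basis S) = nagata_vars S {}"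
proof
  show "zspan (nagata_basis S) \<subseteq> nagata_vars S {}"
    using nagata_basis_in zsubspace_nagata_vars by (rule zm.span_minimal)
  show "nagata_vars S {} \<subseteq> zspan (nagata_basis S)"
    using nagata_vars_finite_support nagata_basis_spans_finite by blast
qed

text \<open>
  Among the levels occurring with a nonzero coefficient in a linear relation, let \<open>P\<close> have maximal
  size. No other occurring level contains \<open>P\<close>, so \<open>D\<^sub>P\<close> kills all terms of other levels; on level \<open>P\<close>
  the images under \<open>D\<^sub>P\<close> are independent.
\<close>

lemma zindependent_nagata_basis: "zindependent (nagata_basis V)"
  unfolding zm.independent_explicit_module
proof (intro allI impI)
  fix t u v
  assume t: "finite t" "t \<subseteq> nagata_basis V" "(\<Sum>b\<in>t. of_int (u b) * b) = 0" "v \<in> t"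
  have "\<forall>b\<in>t. \<exists>P. finite P \<and> b \<in> level_basis P" using t(2) by (auto simp: nagata_basis_def)
  then obtain L where L: "\<forall>b\<in>t. finite (L b) \<and> b \<in> level_basis (L b)" by metis
  show "u v = 0"
  proof (rule ccontr)
    assume "u v \<noteq> 0"
    define S where "S = {b \<in> t. u b \<noteq> 0}"
    have S: "finite S" "S \<noteq> {}" using t(1,4) \<open>u v \<noteq> 0\<close> by (auto simp: S_def)
    have "Max ((\<lambda>b. card (L b)) ` S) \<in> (\<lambda>b. card (L b)) ` S"
      using S by (intro Max_in) auto
    then obtain b0 where "b0 \<in> S" "card (L b0) = Max ((\<lambda>b. card (L b)) ` S)" by auto
    then have b0: "b0 \<in> S" "\<And>b. b \<in> S \<Longrightarrow> card (L b) \<le> card (L b0)"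
      using S(1) by auto
    define P where "P = L b0"
    have P: "finite P" using L b0(1) by (auto simp: P_def S_def)
    note add = additive_diff_op[OF P]
    \<comment> \<open>a level other than \<open>P\<close> of at most the same size does not contain \<open>P\<close>\<close>
    have vanish: "diff_op P b = 0" if "b \<in> S" "L b \<noteq> P" for b
    proof -
      have Lb: "finite (L b)" "b \<in> level_basis (L b)" using L that(1) by (auto simp: S_def)
      have "\<not> P \<subseteq> L b"
        using b0(2)[OF that(1)] that(2) Lb(1) card_seteq[of "L b" P] by (auto simp: P_def)
      then show ?thesis using diff_op_eq_0[OF P] level_basis_in[OF Lb(1)] Lb(2) by blast
    qed
    define S' where "S' = {b \<in> S. L b = P}"
    have S': "finite S'" "S' \<subseteq> level_basis P" using t(1) L by (auto simp: S'_def S_def)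
    have inj: "inj_on (diff_op P) S'"
      using inj_on_level_basis[OF P] S'(2) by (rule inj_on_subset)
    have "0 = diff_op P (\<Sum>b\<in>t. of_int (u b) * b)"
      using t(3) by (simp add: Modules.additive.zero[OF add])
    also have "\<dots> = (\<Sum>b\<in>t. of_int (u b) * diff_op P b)"
      by (simp add: Modules.additive.sum[OF add] additive_of_int_mult[OF add])
    also have "\<dots> = (\<Sum>b\<in>S'. of_int (u b) * diff_op P b)"
    proof (intro sum.mono_neutral_right ballI)
      fix b assume b: "b \<in> t - S'"
      show "of_int (u b) * diff_op P b = 0"
      proof (cases "u b = 0")
        case False
        then have "b \<in> S" "L b \<noteq> P" using b by (auto simp: S'_def S_def)
        then show ?thesis using vanish by simp
      qed simp
    qed (use t(1) in \<open>auto simp: S'_def S_def\<close>)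
    also have "\<dots> = (\<Sum>c\<in>diff_op P ` S'. of_int (u (inv_into S' (diff_op P) c)) * c)"
      using inj by (simp add: sum.reindex inv_into_f_f)
    finally have zero: "(\<Sum>c\<in>diff_op P ` S'. of_int (u (inv_into S' (diff_op P) c)) * c) = 0"
      by simp
    have "b0 \<in> S'" using b0(1) by (simp add: S'_def P_def)
    then have "u (inv_into S' (diff_op P) (diff_op P b0)) = 0"
      using zm.independentD[OF zindependent_level_basis[OF P], of "diff_op P ` S'"
          "\<lambda>c. u (inv_into S' (diff_op P) c)" "diff_op P b0"] zero S' by blast
    then have "u b0 = 0" using \<open>b0 \<in> S'\<close> inj by simp
    then show False using b0(1) by (simp add: S_def)
  qed
qed

section \<open>The ring\<close>

definition nagata_ring :: "'v::linorder set \<Rightarrow> (('v \<Rightarrow>\<^sub>0 int) \<Rightarrow>\<^sub>0 int) fract ring" where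
  "nagata_ring W = \<lparr>carrier = nagata W, monoid.mult = (*), monoid.one = 1, ring.zero = 0, ring.add = (+)\<rparr>"

lemma nagata_ring_simps [simp]:
  "carrier (nagata_ring W) = nagata W" "x \<otimes>\<^bsub>nagata_ring W\<^esub> y = x * y" "\<one>\<^bsub>nagata_ring W\<^esub> = 1"
  "\<zero>\<^bsub>nagata_ring W\<^esub> = 0" "x \<oplus>\<^bsub>nagata_ring W\<^esub> y = x + y"
  by (simp_all add: nagata_ring_def)

lemma domain_nagata_ring: "domain (nagata_ring W)"
proof -
  have "cring (nagata_ring W)"
  proof (rule cringI)
    show "abelian_group (nagata_ring W)"
    proof (rule abelian_groupI)
      show "\<exists>y\<in>carrier (nagata_ring W). y \<oplus>\<^bsub>nagata_ring W\<^esub> x = \<zero>\<^bsub>nagata_ring W\<^esub>"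
        if "x \<in> carrier (nagata_ring W)" for x
        using that nagata_minus[of x W] by (intro bexI[of _ "- x"]) auto
    qed (simp_all add: nagata_add nagata_zero add_ac)
    show "Group.comm_monoid (nagata_ring W)"
      by (rule comm_monoidI) (simp_all add: nagata_mult nagata_one mult_ac)
  qed (simp add: distrib_right)
  then show ?thesis
    by (rule domain.intro) (simp add: domain_axioms_def)
qed

text \<open>
  Up to a unit each element of an ideal is an integer, so the ideal is generated by the least
  positive integer in it.
\<close>

lemma principal_domain_nagata_ring: "principal_domain (nagata_ring W)"
proof -
  interpret domain "nagata_ring W" by (rule domain_nagata_ring)
  show ?thesis
  proof unfold_locales
    fix I assume I: "ideal I (nagata_ring W)"
    interpret I: ideal I "nagata_ring W" by fact
    have sub: "I \<subseteq> nagata W" using I.a_subset by simp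
    have mult: "x * r \<in> I" if "r \<in> I" "x \<in> nagata W" for x r
      using I.I_l_closed[OF that(1)] that(2) by simp
    have add: "x + y \<in> I" if "x \<in> I" "y \<in> I" for x y
      using I.a_closed[OF that] by simp
    have factor: "\<exists>n u. n > 0 \<and> r = of_int n * u \<and> u \<in> nagata W \<and> of_int n \<in> I"
      if r: "r \<in> I" "r \<noteq> 0" for r
    proof -
      obtain n u where nu: "n > 0" "r = of_int n * u" "u \<in> nagata W" "inverse u \<in> nagata W" "u \<noteq> 0"
        using nagata_int_unit_factor[of r W] r sub by blast
      have "inverse u * r = of_int n" using nu(2,5) by simp
      then show ?thesis using mult[OF r(1) nu(4)] nu by metis
    qed
    show "\<exists>a\<in>carrier (nagata_ring W). I = PIdl\<^bsub>nagata_ring W\<^esub> a"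
    proof (cases "\<exists>r\<in>I. r \<noteq> 0")
      case False
      have "0 \<in> I" using additive_subgroup.zero_closed[OF ideal.axioms(1)[OF I]] by simp
      then have "I = {0}" using False by blast
      moreover have "PIdl\<^bsub>nagata_ring W\<^esub> 0 = {0}"
        using nagata_zero[of W] by (auto simp: cgenideal_def)
      ultimately show ?thesis using nagata_zero[of W] by (intro bexI[of _ 0]) simp_all
    next
      case True
      then obtain n0 :: int where "n0 > 0" "of_int n0 \<in> I" using factor by blast
      then have ex: "\<exists>k::nat. k > 0 \<and> of_int (int k) \<in> I"
        by (intro exI[of _ "nat n0"]) simp
      define d where "d = (LEAST k::nat. k > 0 \<and> of_int (int k) \<in> I)"
      have d: "d > 0" "of_int (int d) \<in> I"
        using LeastI_ex[OF ex] by (simp_all add: d_def)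
      have least: "k = 0" if "k < d" "of_int (int k) \<in> I" for k
        using not_less_Least[of k "\<lambda>k::nat. k > 0 \<and> of_int (int k) \<in> I"] that by (auto simp: d_def)
      have "I \<subseteq> PIdl\<^bsub>nagata_ring W\<^esub> (of_int (int d))"
      proof
        fix r assume r: "r \<in> I"
        have "\<exists>s\<in>nagata W. r = s * of_int (int d)"
        proof (cases "r = 0")
          case True
          then show ?thesis using nagata_zero by (intro bexI[of _ 0]) simp_all
        next
          case False
          obtain n u where nu: "n > 0" "r = of_int n * u" "u \<in> nagata W" "of_int n \<in> I"
            using factor[OF r False] by blast
          have "of_int n + of_int (- (n div int d)) * of_int (int d) =
              (of_int (n + - (n div int d) * int d) :: (('a \<Rightarrow>\<^sub>0 int) \<Rightarrow>\<^sub>0 int) fract)"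
            by (simp only: of_int_add of_int_mult)
          moreover have "of_int n + of_int (- (n div int d)) * of_int (int d) \<in> I"
            using add[OF nu(4) mult[OF d(2) nagata_of_int]] .
          ultimately have "of_int (n mod int d) \<in> I"
            by (simp add: minus_div_mult_eq_mod)
          moreover define k where "k = nat (n mod int d)"
          then have k: "n mod int d = int k" "k < d"
            using d(1) by (simp_all add: nat_less_iff)
          ultimately have "k = 0" using least[of k] by simp
          then have "n mod int d = 0" using k(1) by simp
          then obtain q where "n = int d * q" by (auto simp: mod_eq_0_iff_dvd elim: dvdE)
          then have "r = (of_int q * u) * of_int (int d)" using nu(2) by simp
          then show ?thesis using nagata_mult[OF nagata_of_int nu(3)] by blast
        qed
        then show "r \<in> PIdl\<^bsub>nagata_ring W\<^esub> (of_int (int d))" by (auto simp: cgenideal_def)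
      qed
      moreover have "PIdl\<^bsub>nagata_ring W\<^esub> (of_int (int d)) \<subseteq> I"
        using mult[OF d(2)] by (auto simp: cgenideal_def)
      ultimately show ?thesis using nagata_of_int[of "int d" W]
        by (intro bexI[of _ "of_int (int d)"]) simp_all
    qed
  qed
qed

text \<open>
  Generators of the preimage of an ideal are carried to generators of the ideal.
\<close>

lemma (in noetherian_domain) noetherian_domain_image_ring:
  assumes "inj_on f (carrier R)"
  shows "noetherian_domain (image_ring f R)"
proof -
  let ?S = "image_ring f R"
  have f: "f \<in> ring_hom R ?S"
    using inj_imp_image_ring_iso[OF assms] by (simp add: ring_iso_def)
  interpret S: domain ?S using inj_imp_image_ring_is_domain[OF assms] .
  interpret f: ring_hom_ring R ?S f
    using f by (intro ring_hom_ringI2 ring_axioms S.ring_axioms)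
  show ?thesis
  proof (intro noetherian_domain.intro S.noetherian_ringI S.domain_axioms)
    fix I assume I: "ideal I ?S"
    interpret I: ideal I ?S by fact
    obtain A where A: "A \<subseteq> carrier R" "finite A" "{x \<in> carrier R. f x \<in> I} = Idl A"
      using finetely_gen[OF f.ideal_vimage[OF I]] by blast
    have fA: "f ` A \<subseteq> carrier ?S" using A(1) by (auto simp: image_ring_carrier)
    have "A \<subseteq> {x \<in> carrier R. f x \<in> I}" using genideal_self[OF A(1)] A(3) by simp
    then have "Idl\<^bsub>?S\<^esub> (f ` A) \<subseteq> I" using I by (intro S.genideal_minimal) auto
    moreover have "I \<subseteq> Idl\<^bsub>?S\<^esub> (f ` A)"
    proof
      fix y assume y: "y \<in> I"
      then obtain x where x: "x \<in> carrier R" "y = f x"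
        using I.a_subset by (auto simp: image_ring_carrier)
      have "A \<subseteq> {x \<in> carrier R. f x \<in> Idl\<^bsub>?S\<^esub> (f ` A)}"
        using S.genideal_self[OF fA] A(1) by auto
      then have "Idl A \<subseteq> {x \<in> carrier R. f x \<in> Idl\<^bsub>?S\<^esub> (f ` A)}"
        using f.ideal_vimage[OF S.genideal_ideal[OF fA]] by (rule genideal_minimal[rotated])
      then show "y \<in> Idl\<^bsub>?S\<^esub> (f ` A)" using A(3) x y by blast
    qed
    ultimately show "\<exists>A\<subseteq>carrier ?S. finite A \<and> I = Idl\<^bsub>?S\<^esub> A"
      using fA A(2) by (intro exI[of _ "f ` A"]) auto
  qed
qed

lemma zbasis_imp_iso_free_Abelian_group:
  fixes R :: "'k::comm_ring_1 ring"
  assumes B: "zindependent B" "zspan B = carrier R"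
    and add: "\<And>x y. x \<oplus>\<^bsub>R\<^esub> y = x + y"
  shows "free_Abelian_group B \<cong> add_monoid R"
proof -
  define \<phi> :: "('k \<Rightarrow>\<^sub>0 int) \<Rightarrow> 'k" where "\<phi> c = (\<Sum>b\<in>keys c. of_int (lookup c b) * b)" for c
  have \<phi>: "\<phi> c = (\<Sum>b\<in>S. of_int (lookup c b) * b)" if "finite S" "keys c \<subseteq> S" for c S
    unfolding \<phi>_def using that by (intro sum.mono_neutral_left) (auto simp: in_keys_iff)
  have hom: "\<phi> (c + d) = \<phi> c + \<phi> d" for c d
  proof -
    let ?S = "keys c \<union> keys d"
    have "\<phi> (c + d) = (\<Sum>b\<in>?S. of_int (lookup (c + d) b) * b)"
      using keys_add[of c d] by (intro \<phi>) auto
    also have "\<dots> = \<phi> c + \<phi> d"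
      by (simp add: \<phi>[of ?S c] \<phi>[of ?S d] lookup_add distrib_right sum.distrib)
    finally show ?thesis .
  qed
  have inj: "c = d" if c: "keys c \<subseteq> B" "keys d \<subseteq> B" "\<phi> c = \<phi> d" for c d
  proof (rule poly_mapping_eqI)
    fix b
    let ?S = "keys c \<union> keys d"
    have "(\<Sum>b\<in>?S. of_int (lookup c b - lookup d b) * b) = 0"
      using c(3) by (simp add: \<phi>[of ?S c] \<phi>[of ?S d] left_diff_distrib sum_subtractf)
    then have "lookup c b - lookup d b = 0" if "b \<in> ?S"
      using zm.independentD[OF B(1), of ?S "\<lambda>b. lookup c b - lookup d b" b] c that by auto
    then show "lookup c b = lookup d b" by (cases "b \<in> ?S") (auto simp: in_keys_iff)
  qed
  have "\<phi> c \<in> zspan B" if "keys c \<subseteq> B" for c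
    unfolding \<phi>_def using that by (intro zm.span_sum zm.span_scale zm.span_base) auto
  moreover have "\<exists>c. keys c \<subseteq> B \<and> x = \<phi> c" if "x \<in> zspan B" for x
    using that
  proof (induction rule: zm.span_induct_alt)
    case base
    show ?case by (intro exI[of _ 0]) (simp add: \<phi>_def)
  next
    case (step n b y)
    then obtain c where c: "keys c \<subseteq> B" "y = \<phi> c" by blast
    have "\<phi> (Poly_Mapping.single b n) = of_int n * b"
      by (cases "n = 0") (simp_all add: \<phi>_def)
    then have "of_int n * b + y = \<phi> (Poly_Mapping.single b n + c)" by (simp add: hom c(2))
    moreover have "keys (Poly_Mapping.single b n + c) \<subseteq> B"
      using keys_add[of "Poly_Mapping.single b n" c] c(1) step(1) by (auto split: if_splits)
    ultimately show ?case by blast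
  qed
  ultimately have "\<phi> ` {c. keys c \<subseteq> B} = zspan B" by auto
  moreover have "carrier (free_Abelian_group B) = {c. keys c \<subseteq> B}" by auto
  ultimately have "\<phi> \<in> iso (free_Abelian_group B) (add_monoid R)"
    using inj hom B(2) unfolding iso_def hom_def bij_betw_def inj_on_def
    by (auto simp: add)
  then show ?thesis by (rule is_isoI)
qed

lemma free_abelian_image_ring:
  assumes R: "ring R" and inj: "inj_on f (carrier R)" and B: "free_Abelian_group B \<cong> add_monoid R"
    "B \<subseteq> carrier R"
  shows "free_abelian (add_monoid (image_ring f R))"
proof -
  let ?S = "image_ring f R"
  have "f \<in> iso (add_monoid R) (add_monoid ?S)"
  proof (intro isoI homI)
    have h: "f \<in> ring_hom R ?S" and b: "bij_betw f (carrier R) (carrier ?S)"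
      using inj_imp_image_ring_iso[OF inj] by (simp_all add: ring_iso_def)
    show "bij_betw f (carrier (add_monoid R)) (carrier (add_monoid ?S))" using b by simp
    show "f x \<in> carrier (add_monoid ?S)" if "x \<in> carrier (add_monoid R)" for x
      using ring_hom_closed[OF h, of x] that by simp
    show "f (x \<otimes>\<^bsub>add_monoid R\<^esub> y) = f x \<otimes>\<^bsub>add_monoid ?S\<^esub> f y"
      if "x \<in> carrier (add_monoid R)" "y \<in> carrier (add_monoid R)" for x y
      using ring_hom_add[OF h, of x y] that by simp
  qed
  then have 1: "add_monoid R \<cong> add_monoid ?S" by (rule is_isoI)
  have "f ` B \<approx> B" by (rule inj_on_image_eqpoll_self[OF inj_on_subset[OF inj B(2)]])
  then have 2: "free_Abelian_group (f ` B) \<cong> free_Abelian_group B"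
    by (simp add: isomorphic_free_Abelian_groups)
  have "free_Abelian_group (f ` B) \<cong> add_monoid ?S"
    using iso_trans[OF iso_trans[OF 2 B(1)] 1] .
  then have "add_monoid ?S \<cong> free_Abelian_group (f ` B)"
    by (rule group.iso_sym[OF group_free_Abelian_group])
  then show ?thesis unfolding free_abelian_def by blast
qed

text \<open>
  For an infinite set, passing to the free abelian group on it does not change the cardinality;
  doing so twice yields the monomials and the Laurent polynomials in \<open>W\<close>.
\<close>

lemma nagata_eqpoll:
  assumes "infinite W" shows "nagata W \<approx> W"
proof (rule lepoll_antisym)
  have mons: "{m :: 'a \<Rightarrow>\<^sub>0 int. keys m \<subseteq> W} \<approx> W"
    using eqpoll_free_Abelian_group_infinite[OF assms] by (simp add: free_Abelian_group_def)
  then have inf: "infinite {m :: 'a \<Rightarrow>\<^sub>0 int. keys m \<subseteq> W}"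
    using assms eqpoll_finite_iff by blast
  have lp: "lpoly_on W \<approx> W"
    using eqpoll_trans[OF _ mons] eqpoll_free_Abelian_group_infinite[OF inf]
    by (simp add: lpoly_on_eq free_Abelian_group_def)
  have "nagata W \<lesssim> (\<lambda>(f, g). Fract f g) ` (lpoly_on W \<times> lpoly_on W)"
    using nagata_subset_image by (rule subset_imp_lepoll)
  also have "\<dots> \<lesssim> lpoly_on W \<times> lpoly_on W" by (rule image_lepoll)
  also have "\<dots> \<approx> W \<times> W" using lp lp by (rule times_eqpoll_cong)
  also have "\<dots> \<approx> W"
    using assms card_of_Times_same_infinite by (simp add: eqpoll_iff_card_of_ordIso)
  finally show "nagata W \<lesssim> W" .
  have "inj_on (\<lambda>w. Fract (frag_of (frag_of w)) 1 :: (('a \<Rightarrow>\<^sub>0 int) \<Rightarrow>\<^sub>0 int) fract) W"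
    by (auto simp: inj_on_def eq_fract frag_of_eq)
  moreover have "(\<lambda>w. Fract (frag_of (frag_of w)) 1) ` W \<subseteq> nagata W"
    by (auto intro!: nagataI lpoly_on_one primitive_one simp: lpoly_on_def)
  ultimately show "W \<lesssim> nagata W" unfolding lepoll_def by blast
qed

theorem theorem2p40:
  fixes lam :: "'a rel"
  assumes "Card_order lam" and "cinfinite lam"
  shows "\<exists>R :: 'a ring. noetherian_domain R \<and> |carrier R| =o lam \<and> free_abelian (add_monoid R)"
proof -
  define W where "W = insert Base (Var ` Field lam)"
  have inf: "infinite (Field lam)" using assms(2) by (simp add: cinfinite_def)
  have img: "Var ` Field lam \<approx> Field lam"
    by (rule inj_on_image_eqpoll_self) (simp add: inj_on_def)
  then have inf': "infinite (Var ` Field lam)" using inf eqpoll_finite_iff by blast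
  then have "W \<approx> Var ` Field lam" unfolding W_def by (rule infinite_insert_eqpoll)
  then have "W \<approx> Field lam" using img eqpoll_trans by blast
  moreover have "nagata W \<approx> W" using inf' by (intro nagata_eqpoll) (simp add: W_def)
  ultimately have "nagata W \<approx> Field lam" using eqpoll_trans by blast
  then obtain f where f: "bij_betw f (nagata W) (Field lam)" by (auto simp: eqpoll_def)
  then have inj: "inj_on f (carrier (nagata_ring W))" by (simp add: bij_betw_def)
  interpret principal_domain "nagata_ring W" by (rule principal_domain_nagata_ring)
  have W: "nagata W = nagata_vars (Field lam) {}" by (simp add: W_def nagata_vars_def)
  have "free_Abelian_group (nagata_basis (Field lam)) \<cong> add_monoid (nagata_ring W)"
    by (intro zbasis_imp_iso_free_Abelian_group zindependent_nagata_basis) (simp_all add: W zspan_nagata_basis)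
  then have "free_abelian (add_monoid (image_ring f (nagata_ring W)))"
    using nagata_basis_in by (intro free_abelian_image_ring[OF ring_axioms inj]) (auto simp: W)
  moreover have "|carrier (image_ring f (nagata_ring W))| =o lam"
    using f card_of_Field_ordIso[OF assms(1)] by (simp add: image_ring_carrier bij_betw_def)
  ultimately show ?thesis using noetherian_domain_image_ring[OF inj] by blast
qed

end
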